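(* Let $m,n\ge1$, $k\in[1,m]$, $a\in\mathbb{N}$ and $q_1,\dots,q_n\in(0,1)$. Then $$\sum_{\substack{\lambda\in\mathcal{P}_m\\ \lambda_k\le a}}g_\lambda(q_1,\dots,q_n)=\prod_{i=1}^n(1-q_i)^{1-k}\,s_{(a^{m-k+1})}(1^{m-k+1},q_1,\dots,q_n).$$
   Context: $\mathcal{P}_m=\{\lambda=(\lambda_1,\dots,\lambda_m)\in\mathbb{N}^m:\lambda_1\ge\cdots\ge\lambda_m\ge0\}$. A plane partition is a matrix of nonnegative integers with finitely many nonzero entries, weakly decreasing along rows and down columns; its shape is the partition whose $k$-th part is the number of positive entries in row $k$. The dual Grothendieck polynomial is $g_\lambda(x_1,\dots,x_n)=\sum_\pi\prod_{i=1}^n x_i^{c_i(\pi)}$, summed over plane partitions $\pi$ of shape $\lambda$ with largest entry at most $n$, where $c_i(\pi)$ is the number of columns of $\pi$ containing $i$. $s_{(a^r)}$ is the Schur polynomial of the rectangular partition with $r$ parts equal to $a$, and $s_{(a^r)}(1^r,q_1,\dots,q_n)$ is its evaluation in $r+n$ variables, the first $r$ equal to $1$. *)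

theory Defs
  imports "HOL-Analysis.Infinite_Sum"
begin

text \<open>
  Matrices, tableaux and lists of parts are indexed from 0, so the part \<open>\<mu>\<^sub>k\<close> is \<open>\<mu> ! (k - 1)\<close>.
  Polynomials are given by their values: \<open>x\<close> is the list of the values of the variables, and
  the variable with index \<open>i \<ge> 1\<close> is \<open>x ! (i - 1)\<close>.
\<close>

definition partitions_of_length :: "nat \<Rightarrow> nat list set" where
  "partitions_of_length m = {\<mu>. length \<mu> = m \<and> sorted_wrt (\<ge>) \<mu>}"

definition part :: "nat list \<Rightarrow> nat \<Rightarrow> nat" where
  "part \<mu> i = (if i < length \<mu> then \<mu> ! i else 0)"

definition plane_partition :: "(nat \<Rightarrow> nat \<Rightarrow> nat) \<Rightarrow> bool" where
  "plane_partition \<pi> \<longleftrightarrow>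
     finite {(i, j). \<pi> i j \<noteq> 0} \<and>
     (\<forall>i j. \<pi> i (Suc j) \<le> \<pi> i j) \<and>
     (\<forall>i j. \<pi> (Suc i) j \<le> \<pi> i j)"

definition pp_shape :: "(nat \<Rightarrow> nat \<Rightarrow> nat) \<Rightarrow> nat \<Rightarrow> nat" where
  "pp_shape \<pi> i = card {j. \<pi> i j > 0}"

definition plane_partitions :: "nat list \<Rightarrow> nat \<Rightarrow> (nat \<Rightarrow> nat \<Rightarrow> nat) set" where
  "plane_partitions \<mu> n =
     {\<pi>. plane_partition \<pi> \<and> pp_shape \<pi> = part \<mu> \<and> (\<forall>i j. \<pi> i j \<le> n)}"

definition columns_containing :: "(nat \<Rightarrow> nat \<Rightarrow> nat) \<Rightarrow> nat \<Rightarrow> nat" where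
  "columns_containing \<pi> v = card {j. \<exists>i. \<pi> i j = v}"

definition dual_grothendieck :: "nat list \<Rightarrow> 'a::comm_semiring_1 list \<Rightarrow> 'a" where
  "dual_grothendieck \<mu> x =
     (\<Sum>\<pi>\<in>plane_partitions \<mu> (length x).
        \<Prod>v=1..length x. (x ! (v - 1)) ^ columns_containing \<pi> v)"

definition cells :: "nat list \<Rightarrow> (nat \<times> nat) set" where
  "cells \<mu> = {(i, j). j < part \<mu> i}"

text \<open>
  Semistandard tableaux of shape \<open>\<mu>\<close> with entries in \<open>{1..N}\<close>. They are extended by \<open>0\<close>
  outside the diagram, so that distinct functions are distinct tableaux.
\<close>

definition ssyt :: "nat list \<Rightarrow> nat \<Rightarrow> (nat \<Rightarrow> nat \<Rightarrow> nat) set" where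
  "ssyt \<mu> N =
     {T. (\<forall>i j. (i, j) \<in> cells \<mu> \<longrightarrow> T i j \<in> {1..N}) \<and>
         (\<forall>i j. (i, j) \<notin> cells \<mu> \<longrightarrow> T i j = 0) \<and>
         (\<forall>i j. (i, Suc j) \<in> cells \<mu> \<longrightarrow> T i j \<le> T i (Suc j)) \<and>
         (\<forall>i j. (Suc i, j) \<in> cells \<mu> \<longrightarrow> T i j < T (Suc i) j)}"

definition schur :: "nat list \<Rightarrow> 'a::comm_semiring_1 list \<Rightarrow> 'a" where
  "schur \<mu> x = (\<Sum>T\<in>ssyt \<mu> (length x). \<Prod>(i, j)\<in>cells \<mu>. x ! (T i j - 1))"

text \<open>The index sets of both sums are finite, so neither sum degenerates to \<open>0\<close>.\<close>

lemma finite_cells: "finite (cells \<mu>)"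
proof (rule finite_subset)
  show "cells \<mu> \<subseteq> (SIGMA i:{..<length \<mu>}. {..<\<mu> ! i})"
    by (auto simp: cells_def part_def split: if_splits)
qed auto

lemma finite_bounded_fillings:
  assumes "finite A"
  shows "finite {f :: nat \<Rightarrow> nat \<Rightarrow> nat. (\<forall>i j. f i j \<le> N) \<and> (\<forall>i j. (i, j) \<notin> A \<longrightarrow> f i j = 0)}"
    (is "finite ?F")
proof -
  have "finite {g. \<forall>p. (p \<in> A \<longrightarrow> g p \<in> {..N}) \<and> (p \<notin> A \<longrightarrow> g p = 0)}" (is "finite ?G")
    by (rule finite_set_of_finite_funs) (use assms in auto)
  moreover have "?F \<subseteq> curry ` ?G"
  proof
    fix f assume "f \<in> ?F"
    then have "case_prod f \<in> ?G" by auto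
    then have "curry (case_prod f) \<in> curry ` ?G" by (rule imageI)
    then show "f \<in> curry ` ?G" by simp
  qed
  ultimately show ?thesis by (meson finite_imageI finite_subset)
qed

lemma finite_ssyt: "finite (ssyt \<mu> N)"
proof (rule finite_subset[OF _ finite_bounded_fillings[OF finite_cells[of \<mu>], of N]])
  show "ssyt \<mu> N \<subseteq> {f. (\<forall>i j. f i j \<le> N) \<and> (\<forall>i j. (i, j) \<notin> cells \<mu> \<longrightarrow> f i j = 0)}"
    unfolding ssyt_def by (auto, metis atLeastAtMost_iff le0)
qed

lemma plane_partition_support:
  assumes "\<pi> \<in> plane_partitions \<mu> n"
  shows "\<pi> i j > 0 \<longleftrightarrow> (i, j) \<in> cells \<mu>"
proof -
  have pp: "plane_partition \<pi>" and sh: "card {j. \<pi> i j > 0} = part \<mu> i"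
    using assms by (auto simp: plane_partitions_def pp_shape_def fun_eq_iff)
  have fin: "finite {j. \<pi> i j > 0}"
  proof (rule finite_subset)
    show "{j. \<pi> i j > 0} \<subseteq> snd ` {(i, j). \<pi> i j \<noteq> 0}" by force
    show "finite (snd ` {(i, j). \<pi> i j \<noteq> 0})"
      using pp by (auto simp: plane_partition_def)
  qed
  have "antimono (\<pi> i)"
    using pp by (auto simp: plane_partition_def antimono_iff_le_Suc)
  then have down: "\<pi> i j' > 0" if "\<pi> i j > 0" "j' \<le> j" for j j'
    using that antimonoD[of "\<pi> i" j' j] by linarith
  show ?thesis
  proof
    assume "\<pi> i j > 0"
    then have "{..j} \<subseteq> {j. \<pi> i j > 0}" using down by auto
    from card_mono[OF fin this] show "(i, j) \<in> cells \<mu>" using sh by (simp add: cells_def)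
  next
    assume c: "(i, j) \<in> cells \<mu>"
    show "\<pi> i j > 0"
    proof (rule ccontr)
      assume "\<not> \<pi> i j > 0"
      then have "{j. \<pi> i j > 0} \<subseteq> {..<j}" 
        using down by (force simp: not_less[symmetric])
      from card_mono[OF _ this] show False using sh c by (simp add: cells_def)
    qed
  qed
qed

lemma finite_plane_partitions: "finite (plane_partitions \<mu> n)"
proof (rule finite_subset[OF _ finite_bounded_fillings[OF finite_cells[of \<mu>], of n]])
  show "plane_partitions \<mu> n \<subseteq>
      {f. (\<forall>i j. f i j \<le> n) \<and> (\<forall>i j. (i, j) \<notin> cells \<mu> \<longrightarrow> f i j = 0)}"
    using plane_partition_support[of _ \<mu> n] by (auto simp: plane_partitions_def)
qed

end

theory Submission
  imports Defs "Jordan_Normal_Form.Determinant" "HOL-Analysis.Elementary_Metric_Spaces"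
begin

text \<open>
  Subtracting \<open>1\<close> from the positive entries of a plane partition of shape \<open>\<mu>\<close> leaves a plane
  partition of some shape \<open>\<nu> \<subseteq> \<mu>\<close>, and the number of columns that contained a \<open>1\<close> is
  \<open>\<Sum>\<^sub>i (\<mu>\<^sub>i - max \<nu>\<^sub>i \<mu>\<^sub>i\<^sub>+\<^sub>1)\<close>. This branching rule has two consequences.

  First, summing \<open>g\<^sub>\<mu>\<close> over the first part alone is a geometric series in each variable: it
  multiplies the polynomial of the remaining parts by \<open>\<Prod>\<^sub>i (1 - q\<^sub>i)\<^sup>-\<^sup>1\<close>. Doing this \<open>k - 1\<close> times
  reduces the theorem to \<open>k = 1\<close>.

  Second, the rule yields \<open>g\<^sub>\<mu>(x) = det h(x, 1\<^sup>i\<^sup>-\<^sup>1; \<mu>\<^sub>i - i + j)\<close>, where \<open>h(y; d)\<close> is the complete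
  homogeneous polynomial of degree \<open>d\<close> in \<open>y\<close>. Summing the rows of this determinant one after the
  other over \<open>a \<ge> \<mu>\<^sub>1 \<ge> \<mu>\<^sub>2 \<ge> \<dots>\<close> telescopes modulo the following row and gives
  \<open>det h(x, 1\<^sup>i; a - i + j)\<close>; row operations turn this into \<open>det h(x, 1\<^sup>m; a - i + j)\<close>, which is the
  Jacobi--Trudi determinant of \<open>s\<close> for the rectangle.
\<close>

section \<open>Row operations and sums over partitions\<close>

definition row_det :: "nat \<Rightarrow> (nat \<Rightarrow> nat \<Rightarrow> 'a::comm_ring_1) \<Rightarrow> 'a" where
  "row_det m r = det (mat m m (\<lambda>(i, j). r i j))"

lemma row_det_cong:
  assumes "\<And>i j. i < m \<Longrightarrow> j < m \<Longrightarrow> r i j = s i j"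
  shows "row_det m r = row_det m s"
  unfolding row_det_def by (rule arg_cong[of _ _ det]) (auto intro!: eq_matI simp: assms)

lemma row_det_leibniz:
  "row_det m r = (\<Sum>p | p permutes {0..<m}. signof p * (\<Prod>i = 0..<m. r i (p i)))"
proof -
  have "row_det m r = (\<Sum>p | p permutes {0..<m}. signof p *
      (\<Prod>i = 0..<m. mat m m (\<lambda>(i, j). r i j) $$ (i, p i)))"
    unfolding row_det_def by (rule det_def') simp
  also have "\<dots> = (\<Sum>p | p permutes {0..<m}. signof p * (\<Prod>i = 0..<m. r i (p i)))"
  proof (intro sum.cong refl arg_cong2[of _ _ _ _ "(*)"] prod.cong)
    fix p i assume "p \<in> {p. p permutes {0..<m}}" and "i \<in> {0..<m}"
    then show "mat m m (\<lambda>(i, j). r i j) $$ (i, p i) = r i (p i)"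
      using permutes_in_image[of p "{0..<m}" i] by auto
  qed
  finally show ?thesis .
qed

lemma row_det_sum_row:
  assumes "k < m"
  shows "row_det m (r(k := \<lambda>j. \<Sum>x\<in>S. w x * g x j)) = (\<Sum>x\<in>S. w x * row_det m (r(k := g x)))"
proof -
  have split: "(\<Prod>i = 0..<m. (r(k := v)) i (p i)) = v (p k) * (\<Prod>i\<in>{0..<m} - {k}. r i (p i))"
    for v p
  proof -
    have "(\<Prod>i = 0..<m. (r(k := v)) i (p i))
        = (r(k := v)) k (p k) * (\<Prod>i\<in>{0..<m} - {k}. (r(k := v)) i (p i))"
      by (rule prod.remove) (use assms in auto)
    also have "(\<Prod>i\<in>{0..<m} - {k}. (r(k := v)) i (p i)) = (\<Prod>i\<in>{0..<m} - {k}. r i (p i))"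
      by (rule prod.cong) auto
    finally show ?thesis by simp
  qed
  show ?thesis
    unfolding row_det_leibniz split sum_distrib_right sum_distrib_left
    by (subst sum.swap) (simp add: mult_ac)
qed

lemma row_det_add_row:
  assumes "l < m" "l \<noteq> k"
  shows "row_det m (r(k := \<lambda>j. u j + c * r l j)) = row_det m (r(k := u))"
proof -
  let ?A = "mat m m (\<lambda>(i, j). (r(k := u)) i j)"
  have "mat m m (\<lambda>(i, j). (r(k := \<lambda>j. u j + c * r l j)) i j) = addrow c k l ?A"
    by (rule eq_matI) (use assms in \<open>auto simp: add.commute\<close>)
  then show ?thesis
    using det_addrow[of l m k ?A c] assms by (simp add: row_det_def)
qed

lemma row_det_unitriangular:
  assumes "\<And>i. i < m \<Longrightarrow> r i i = 1" and "\<And>i j. j < i \<Longrightarrow> i < m \<Longrightarrow> r i j = 0"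
  shows "row_det m r = 1"
proof -
  let ?A = "mat m m (\<lambda>(i, j). r i j)"
  have "det ?A = prod_list (diag_mat ?A)"
    by (rule det_upper_triangular) (auto simp: assms upper_triangular_def)
  also have "diag_mat ?A = replicate m 1"
    by (rule nth_equalityI) (auto simp: diag_mat_def assms)
  finally show ?thesis by (simp add: row_det_def prod_list_replicate)
qed

lemma row_det_zero_row:
  assumes "k < m" "\<And>j. j < m \<Longrightarrow> r k j = 0"
  shows "row_det m r = 0"
  unfolding row_det_leibniz
proof (intro sum.neutral ballI)
  fix p assume "p \<in> {p. p permutes {0..<m}}"
  then have "r k (p k) = 0"
    using permutes_in_image[of p "{0..<m}" k] assms by auto
  then have "(\<Prod>i = 0..<m. r i (p i)) = 0"
    using assms(1) by (intro prod_zero) auto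
  then show "signof p * (\<Prod>i = 0..<m. r i (p i)) = 0" by simp
qed

text \<open>Covers the last row as well: there is no row below it to subtract, so the added vector
  must itself vanish. Telescoping arguments can then treat all rows alike.\<close>

lemma row_det_add_next_row:
  assumes "k < m" and "Suc k < m \<or> (\<forall>j<m. v j = 0)" and "Suc k < m \<Longrightarrow> \<forall>j<m. r (Suc k) j = v j"
  shows "row_det m (r(k := \<lambda>j. u j + c * v j)) = row_det m (r(k := u))"
proof (cases "Suc k < m")
  case True
  have "row_det m (r(k := \<lambda>j. u j + c * v j)) = row_det m (r(k := \<lambda>j. u j + c * r (Suc k) j))"
    by (rule row_det_cong) (use True assms in auto)
  also have "\<dots> = row_det m (r(k := u))"
    by (rule row_det_add_row) (use True in auto)
  finally show ?thesis .
next
  case False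
  show ?thesis
    by (rule row_det_cong) (use False assms in auto)
qed

text \<open>\<open>r\<close> is \<open>t\<close> multiplied from the left by an upper unitriangular
  bidiagonal matrix. Rows are exchanged from the top down, so row \<open>Suc l\<close> is still that
  of \<open>t\<close> when row \<open>l\<close> is treated.\<close>

lemma row_det_bidiagonal:
  assumes step: "\<And>i. i < m \<Longrightarrow> \<exists>c. \<forall>j<m. r i j = t i j + c * t (Suc i) j"
    and last: "\<And>j. j < m \<Longrightarrow> t m j = 0"
  shows "row_det m r = row_det m t"
proof -
  have "row_det m (\<lambda>i. if i < l then r i else t i) = row_det m t" if "l \<le> m" for l
    using that
  proof (induction l)
    case (Suc l)
    let ?s = "\<lambda>i. if i < l then r i else t i"
    obtain c where c: "\<forall>j<m. r l j = t l j + c * t (Suc l) j"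
      using step[of l] Suc.prems by auto
    have "row_det m (\<lambda>i. if i < Suc l then r i else t i)
        = row_det m (?s(l := \<lambda>j. t l j + c * t (Suc l) j))"
      by (rule row_det_cong) (use c in \<open>auto simp: less_Suc_eq\<close>)
    also have "\<dots> = row_det m (?s(l := t l))"
      by (rule row_det_add_next_row) (use Suc.prems last le_antisym[of "Suc l" m] in \<open>auto simp: not_less\<close>)
    also have "?s(l := t l) = ?s" by auto
    finally show ?case using Suc by simp
  qed simp
  from this[of m] have "row_det m (\<lambda>i. if i < m then r i else t i) = row_det m t" by simp
  moreover have "row_det m (\<lambda>i. if i < m then r i else t i) = row_det m r"
    by (rule row_det_cong) simp
  ultimately show ?thesis by simp
qed

section \<open>Partitions contained in a given one, and determinants summed over them\<close>

definition bounded_partitions :: "nat list \<Rightarrow> nat list set" where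
  "bounded_partitions \<mu> =
     {\<nu> \<in> partitions_of_length (length \<mu>). \<forall>i<length \<mu>. \<nu> ! i \<le> \<mu> ! i}"

lemma part_Nil [simp]: "part [] i = 0"
  by (simp add: part_def)

lemma part_Cons_0 [simp]: "part (x # \<mu>) 0 = x"
  by (simp add: part_def)

lemma part_Cons_Suc [simp]: "part (x # \<mu>) (Suc i) = part \<mu> i"
  by (simp add: part_def)

lemma Cons_in_partitions_of_length:
  "x # \<mu> \<in> partitions_of_length m \<longleftrightarrow>
     (\<exists>m'. m = Suc m' \<and> \<mu> \<in> partitions_of_length m') \<and> part \<mu> 0 \<le> x"
  by (cases \<mu>) (auto simp: partitions_of_length_def)

lemma bounded_partitions_Nil [simp]: "bounded_partitions [] = {[]}"
  by (auto simp: bounded_partitions_def partitions_of_length_def)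

lemma Cons_in_bounded_partitions:
  "x # \<nu> \<in> bounded_partitions (y # \<mu>) \<longleftrightarrow>
     \<nu> \<in> bounded_partitions \<mu> \<and> part \<nu> 0 \<le> x \<and> x \<le> y"
  unfolding bounded_partitions_def
  by (auto simp: Cons_in_partitions_of_length nth_Cons' less_Suc_eq_0_disj)

lemma finite_bounded_partitions [simp]: "finite (bounded_partitions \<mu>)"
proof (rule finite_subset)
  show "bounded_partitions \<mu> \<subseteq> {\<nu>. set \<nu> \<subseteq> {..Max (set \<mu>)} \<and> length \<nu> = length \<mu>}"
    by (auto simp: bounded_partitions_def partitions_of_length_def in_set_conv_nth)
      (meson List.finite_set Max_ge le_trans nth_mem)
qed (simp add: finite_lists_length_eq)

lemma bounded_partitions_Cons:
  "bounded_partitions (y # \<mu>) =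
     (\<lambda>(\<nu>, x). x # \<nu>) ` (SIGMA \<nu>:bounded_partitions \<mu>. {part \<nu> 0..y})"
proof -
  have "\<exists>x \<nu>. \<nu>' = x # \<nu>" if "\<nu>' \<in> bounded_partitions (y # \<mu>)" for \<nu>'
    using that by (cases \<nu>') (auto simp: bounded_partitions_def partitions_of_length_def)
  then show ?thesis
    by (force simp: Cons_in_bounded_partitions image_iff)
qed

text \<open>The first part sees the others only through the lower end of its range, so it can be
  summed first.\<close>

lemma sum_bounded_partitions_Cons:
  "(\<Sum>\<nu>\<in>bounded_partitions (y # \<mu>). f \<nu>) =
     (\<Sum>\<nu>\<in>bounded_partitions \<mu>. \<Sum>x=part \<nu> 0..y. f (x # \<nu>))"
proof -
  have "inj_on (\<lambda>(\<nu>, x). x # \<nu>) A" for A :: "(nat list \<times> nat) set"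
    by (auto simp: inj_on_def)
  then have "(\<Sum>\<nu>\<in>bounded_partitions (y # \<mu>). f \<nu>) =
      (\<Sum>(\<nu>, x)\<in>(SIGMA \<nu>:bounded_partitions \<mu>. {part \<nu> 0..y}). f (x # \<nu>))"
    unfolding bounded_partitions_Cons by (subst sum.reindex) (auto simp: case_prod_unfold)
  then show ?thesis
    by (simp add: sum.Sigma)
qed

lemma part_le_of_bounded_partitions:
  "\<nu> \<in> bounded_partitions \<mu> \<Longrightarrow> part \<nu> i \<le> part \<mu> i"
  by (auto simp: bounded_partitions_def partitions_of_length_def part_def)

text \<open>
  The sum over the leading part of \<open>\<nu>\<close> depends on the next part only through a multiple of the next
  row, which the determinant does not see; so the parts can be summed one after the other.
\<close>

lemma sum_bounded_partitions_row_det: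
  fixes w :: "nat \<Rightarrow> nat \<Rightarrow> 'a::comm_ring_1"
  assumes m: "length \<mu> = m"
    and step: "\<And>i v. i < m \<Longrightarrow> v \<le> part \<mu> (Suc i) \<Longrightarrow>
      \<exists>c. \<forall>j<m. (\<Sum>x=v..part \<mu> i. w i x * r i x j) = s i j + c * r (Suc i) v j"
    and last: "\<And>j. j < m \<Longrightarrow> r m 0 j = 0"
  shows "(\<Sum>\<nu>\<in>bounded_partitions \<mu>.
      (\<Prod>i<m. w i (part \<nu> i)) * row_det m (\<lambda>i. r i (part \<nu> i))) = row_det m s"
proof -
  \<comment> \<open>Generalised for the induction, which descends from \<open>m\<close> to
    \<open>0\<close>: the first \<open>k\<close> parts are already summed and their rows have the
    final form \<open>s\<close>; \<open>\<nu>\<close> lists the remaining parts.\<close>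
  have "(\<Sum>\<nu>\<in>bounded_partitions (drop k \<mu>). (\<Prod>i<m - k. w (k + i) (part \<nu> i)) *
      row_det m (\<lambda>i. if i < k then s i else r i (part \<nu> (i - k)))) = row_det m s"
    if "k \<le> m" for k
    using that
  proof (induction k rule: inc_induct)
    case base
    have "row_det m (\<lambda>i. if i < m then s i else r i (part \<nu> (i - m))) = row_det m s" for \<nu>
      by (rule row_det_cong) simp
    then show ?case using m by simp
  next
    case (step k)
    define f where "f \<nu> = (\<lambda>i. if i < Suc k then s i else r i (part \<nu> (i - Suc k)))" for \<nu>
    have k: "drop k \<mu> = part \<mu> k # drop (Suc k) \<mu>"
      using step.hyps m by (simp add: Cons_nth_drop_Suc part_def)
    have row: "(\<Sum>x=part \<nu> 0..part \<mu> k. (\<Prod>i<m - k. w (k + i) (part (x # \<nu>) i)) *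
          row_det m (\<lambda>i. if i < k then s i else r i (part (x # \<nu>) (i - k))))
        = (\<Prod>i<m - Suc k. w (Suc k + i) (part \<nu> i)) * row_det m (f \<nu>)"
      if \<nu>: "\<nu> \<in> bounded_partitions (drop (Suc k) \<mu>)" for \<nu>
    proof -
      have len: "length \<nu> = m - Suc k"
        using \<nu> m by (auto simp: bounded_partitions_def partitions_of_length_def)
      have le: "part \<nu> 0 \<le> part \<mu> (Suc k)"
        using part_le_of_bounded_partitions[OF \<nu>, of 0] m by (auto simp: part_def)
      obtain c where c: "\<forall>j<m. (\<Sum>x=part \<nu> 0..part \<mu> k. w k x * r k x j)
          = s k j + c * r (Suc k) (part \<nu> 0) j"
        using assms(2)[OF step.hyps(2) le] by blast
      have w: "(\<Prod>i<m - k. w (k + i) (part (x # \<nu>) i)) =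
          w k x * (\<Prod>i<m - Suc k. w (Suc k + i) (part \<nu> i))" for x
      proof -
        have "m - k = Suc (m - Suc k)" using step.hyps by simp
        then show ?thesis by (simp add: prod.lessThan_Suc_shift del: prod.lessThan_Suc)
      qed
      have d: "row_det m (\<lambda>i. if i < k then s i else r i (part (x # \<nu>) (i - k)))
          = row_det m ((f \<nu>)(k := r k x))" for x
      proof (rule row_det_cong)
        fix i j assume "i < m"
        show "(if i < k then s i else r i (part (x # \<nu>) (i - k))) j = ((f \<nu>)(k := r k x)) i j"
          using Suc_diff_Suc[of k i] part_Cons_Suc[of x \<nu> "i - Suc k"]
          by (cases i k rule: linorder_cases) (auto simp: f_def)
      qed
      have "(\<Sum>x=part \<nu> 0..part \<mu> k. w k x * row_det m ((f \<nu>)(k := r k x)))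
          = row_det m ((f \<nu>)(k := \<lambda>j. \<Sum>x=part \<nu> 0..part \<mu> k. w k x * r k x j))"
        by (rule row_det_sum_row[symmetric]) (use step.hyps in auto)
      also have "\<dots> = row_det m ((f \<nu>)(k := \<lambda>j. s k j + c * r (Suc k) (part \<nu> 0) j))"
        by (rule row_det_cong) (use c in auto)
      also have "\<dots> = row_det m ((f \<nu>)(k := s k))"
      proof (rule row_det_add_next_row)
        show "Suc k < m \<or> (\<forall>j<m. r (Suc k) (part \<nu> 0) j = 0)"
        proof (cases "Suc k < m")
          case False
          \<comment> \<open>The last part has no successor, and \<open>part [] 0 = 0\<close> stands
            in for it. Hence the hypothesis on row \<open>m\<close> concerns the value
            \<open>0\<close>.\<close>
          then have "Suc k = m" and "\<nu> = []" using step.hyps len by auto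
          then show ?thesis using last by simp
        qed simp
      qed (use step.hyps in \<open>auto simp: f_def\<close>)
      also have "(f \<nu>)(k := s k) = f \<nu>" by (auto simp: f_def)
      finally have "(\<Prod>i<m - Suc k. w (Suc k + i) (part \<nu> i)) * row_det m (f \<nu>) =
          (\<Prod>i<m - Suc k. w (Suc k + i) (part \<nu> i)) *
            (\<Sum>x=part \<nu> 0..part \<mu> k. w k x * row_det m ((f \<nu>)(k := r k x)))"
        by (simp only:)
      then show ?thesis
        unfolding w d sum_distrib_left by (simp only: mult_ac)
    qed
    show ?case
      unfolding k sum_bounded_partitions_Cons using step.IH row by (simp add: f_def)
  qed
  from this[of 0] show ?thesis by simp
qed

section \<open>Complete homogeneous symmetric polynomials\<close>

text \<open>The coefficients of the generating function of the complete homogeneous polynomials.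
  Integer degrees, with value \<open>0\<close> below degree zero, are what the entries of
  Jacobi-Trudi matrices require; a multiset of variables builds in the symmetry.\<close>

definition complete_homogeneous :: "'a::field multiset \<Rightarrow> int \<Rightarrow> 'a" where
  "complete_homogeneous M k =
     (if k < 0 then 0 else fps_nth (\<Prod>x\<in>#M. inverse (1 - fps_const x * fps_X)) (nat k))"

lemma complete_homogeneous_neg [simp]: "k < 0 \<Longrightarrow> complete_homogeneous M k = 0"
  by (simp add: complete_homogeneous_def)

lemma complete_homogeneous_empty: "complete_homogeneous {#} k = (if k = 0 then 1 else 0)"
  by (auto simp: complete_homogeneous_def)

lemma complete_homogeneous_0 [simp]: "complete_homogeneous M 0 = 1"
  by (induction M) (auto simp: complete_homogeneous_def fps_mult_nth)

text \<open>Multiplying the generating function by \<open>1 - x X\<close> removes the variable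
  \<open>x\<close>; compare coefficients.\<close>

lemma complete_homogeneous_add_mset:
  "complete_homogeneous (add_mset x M) k =
     complete_homogeneous M k + x * complete_homogeneous (add_mset x M) (k - 1)"
proof -
  define P where "P M = (\<Prod>x\<in>#M. inverse (1 - fps_const x * fps_X))" for M :: "'a multiset"
  define u where "u = inverse (1 - fps_const x * fps_X)"
  have u: "u * (1 - fps_const x * fps_X) = 1"
    unfolding u_def by (rule inverse_mult_eq_1) simp
  have "u * P M = (u * (1 - fps_const x * fps_X)) * P M + fps_X * (fps_const x * (u * P M))"
    by (simp add: algebra_simps)
  then have eq: "P (add_mset x M) = P M + fps_X * (fps_const x * P (add_mset x M))"
    unfolding u by (simp add: P_def u_def)
  have "fps_nth (P (add_mset x M)) l =
      fps_nth (P M) l + (if l = 0 then 0 else x * fps_nth (P (add_mset x M)) (l - 1))" for l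
    using arg_cong[OF eq, of "\<lambda>f. fps_nth f l"] by (simp add: fps_X_mult_nth)
  from this[of "nat k"] show ?thesis
    by (auto simp: complete_homogeneous_def P_def nat_diff_distrib)
qed

text \<open>Expand the polynomial in \<open>x\<close>, \<open>y\<close> and \<open>M\<close> once by
  removing \<open>x\<close> and once by removing \<open>y\<close>, and equate.\<close>

lemma complete_homogeneous_diff:
  "complete_homogeneous (add_mset x M) k - complete_homogeneous (add_mset y M) k =
     (x - y) * complete_homogeneous (add_mset x (add_mset y M)) (k - 1)"
  using complete_homogeneous_add_mset[of x "add_mset y M" k]
    complete_homogeneous_add_mset[of y "add_mset x M" k]
  by (simp add: algebra_simps add_mset_commute)

text \<open>Rewriting each summand as a difference in the alphabet enlarged by \<open>x\<close>
  makes the weighted sum telescope. The empty range \<open>v = Suc l\<close> is included, since it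
  occurs when two consecutive parts are equal.\<close>

lemma sum_powers_complete_homogeneous:
  assumes "v \<le> Suc l"
  shows "(\<Sum>u=v..l. x ^ (l - u) * complete_homogeneous M (int u + c)) =
    complete_homogeneous (add_mset x M) (int l + c)
      - x ^ (Suc l - v) * complete_homogeneous (add_mset x M) (int v - 1 + c)"
  using assms
proof (induction l)
  case 0
  then show ?case
    using complete_homogeneous_add_mset[of x M c] by (cases v) (auto simp: algebra_simps)
next
  case (Suc l)
  show ?case
  proof (cases "v = Suc (Suc l)")
    case False
    then have v: "v \<le> Suc l" using Suc.prems by simp
    have "(\<Sum>u=v..Suc l. x ^ (Suc l - u) * complete_homogeneous M (int u + c))
        = x * (\<Sum>u=v..l. x ^ (l - u) * complete_homogeneous M (int u + c))
          + complete_homogeneous M (int (Suc l) + c)"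
      using v by (simp add: sum_distrib_left Suc_diff_le mult.assoc)
    also note Suc.IH[OF v]
    finally show ?thesis
      using complete_homogeneous_add_mset[of x M "int (Suc l) + c"] v
      by (simp add: algebra_simps Suc_diff_le)
  qed simp
qed

section \<open>Rows of Jacobi-Trudi matrices and their sums over a part\<close>

definition jt_row :: "'a::field multiset \<Rightarrow> nat \<Rightarrow> nat \<Rightarrow> nat \<Rightarrow> 'a" where
  "jt_row M i x j = complete_homogeneous M (int x - int i + int j)"

lemma jt_row_zero: "j < i \<Longrightarrow> jt_row M i 0 j = 0"
  by (simp add: jt_row_def)

text \<open>The lower boundary term has degree \<open>v - 1 - i + j\<close>, which is the entry of
  row \<open>Suc i\<close> for the part \<open>v\<close>. This is why boundary terms can be cleared
  by the next row.\<close>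

lemma sum_powers_jt_row:
  assumes "v \<le> Suc l"
  shows "(\<Sum>u=v..l. x ^ (l - u) * jt_row M i u j) =
    jt_row (add_mset x M) i l j - x ^ (Suc l - v) * jt_row (add_mset x M) (Suc i) v j"
  using sum_powers_complete_homogeneous[OF assms, of x M "int j - int i"]
  by (simp add: jt_row_def algebra_simps)

lemma jt_row_diff:
  "jt_row (add_mset x M) i u j - jt_row (add_mset y M) i u j =
     (x - y) * jt_row (add_mset x (add_mset y M)) (Suc i) u j"
  using complete_homogeneous_diff[of x M "int u - int i + int j" y]
  by (simp add: jt_row_def algebra_simps)

text \<open>The case without variables of both Jacobi-Trudi formulas. A positive first part makes
  row \<open>0\<close> vanish, so only its alphabet has to be empty; if all parts are zero the
  matrix is upper unitriangular, whatever the other alphabets are.\<close>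

lemma row_det_jt_row_empty:
  assumes "\<mu> \<in> partitions_of_length m" and "f 0 = {#}"
  shows "row_det m (\<lambda>i. jt_row (f i) i (part \<mu> i)) = (if \<forall>i. part \<mu> i = 0 then 1 else 0)"
proof (cases "\<forall>i. part \<mu> i = 0")
  case True
  then show ?thesis by (auto intro!: row_det_unitriangular simp: jt_row_def)
next
  case False
  then obtain x \<nu> where \<mu>: "\<mu> = x # \<nu>" by (cases \<mu>) auto
  have "x \<noteq> 0"
  proof
    assume "x = 0"
    then have "set \<mu> \<subseteq> {0}" using assms(1) by (auto simp: \<mu> partitions_of_length_def)
    then have "part \<mu> i = 0" for i using nth_mem[of i \<mu>] by (fastforce simp: part_def)
    with False show False by simp
  qed
  have "row_det m (\<lambda>i. jt_row (f i) i (part \<mu> i)) = 0"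
  proof (rule row_det_zero_row)
    show "0 < m" using assms(1) by (auto simp: \<mu> partitions_of_length_def)
    show "jt_row (f 0) 0 (part \<mu> 0) j = 0" for j
      using \<open>x \<noteq> 0\<close> by (simp add: assms \<mu> jt_row_def complete_homogeneous_empty)
  qed
  then show ?thesis using False by simp
qed

lemma part_antimono:
  assumes "\<mu> \<in> partitions_of_length m" and "i \<le> j"
  shows "part \<mu> j \<le> part \<mu> i"
  using assms sorted_wrt_nth_less[of "(\<ge>)" \<mu> i j]
  by (cases "i = j") (auto simp: part_def partitions_of_length_def)

text \<open>The determinant side of the branching rule of Schur polynomials. Each row telescopes to
  the row of the larger alphabet plus a multiple of the next such row.\<close>

lemma sum_jt_row_schur_branching:
  assumes \<mu>: "\<mu> \<in> partitions_of_length m"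
  shows "(\<Sum>\<nu>\<in>bounded_partitions \<mu>.
      (\<Prod>i<m. if part \<mu> (Suc i) \<le> part \<nu> i then y ^ (part \<mu> i - part \<nu> i) else 0)
        * row_det m (\<lambda>i. jt_row M i (part \<nu> i)))
    = row_det m (\<lambda>i. jt_row (add_mset y M) i (part \<mu> i))"
    (is "?lhs = _")
proof -
  define s where "s i j = (\<Sum>u=part \<mu> (Suc i)..part \<mu> i. y ^ (part \<mu> i - u) * jt_row M i u j)"
    for i j
  have "?lhs = row_det m s"
  proof (rule sum_bounded_partitions_row_det)
    show "length \<mu> = m" using \<mu> by (simp add: partitions_of_length_def)
    fix i v assume v: "v \<le> part \<mu> (Suc i)"
    have "(\<Sum>x=v..part \<mu> i. (if part \<mu> (Suc i) \<le> x then y ^ (part \<mu> i - x) else 0) * jt_row M i x j)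
        = s i j" for j
      unfolding s_def by (rule sum.mono_neutral_cong_right) (use v in auto)
    then show "\<exists>c. \<forall>j<m.
        (\<Sum>x=v..part \<mu> i. (if part \<mu> (Suc i) \<le> x then y ^ (part \<mu> i - x) else 0) * jt_row M i x j)
          = s i j + c * jt_row M (Suc i) v j"
      \<comment> \<open>The weight vanishes below \<open>part \<mu> (Suc i)\<close>, so the sum does
        not depend on \<open>v\<close> and leaves no multiple of the next row.\<close>
      by (intro exI[of _ 0]) simp
  qed (simp add: jt_row_zero)
  also have "\<dots> = row_det m (\<lambda>i. jt_row (add_mset y M) i (part \<mu> i))"
  proof (rule row_det_bidiagonal)
    fix i
    have "part \<mu> (Suc i) \<le> Suc (part \<mu> i)"
      using part_antimono[OF \<mu>, of i "Suc i"] by simp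
    then show "\<exists>c. \<forall>j<m. s i j = jt_row (add_mset y M) i (part \<mu> i) j
        + c * jt_row (add_mset y M) (Suc i) (part \<mu> (Suc i)) j"
      unfolding s_def
      by (intro exI[of _ "- (y ^ (Suc (part \<mu> i) - part \<mu> (Suc i)))"]) (simp add: sum_powers_jt_row)
  next
    fix j assume "j < m"
    moreover have "part \<mu> m = 0" using \<mu> by (simp add: part_def partitions_of_length_def)
    ultimately show "jt_row (add_mset y M) m (part \<mu> m) j = 0" by (simp add: jt_row_zero)
  qed
  finally show ?thesis .
qed

text \<open>The range of each part is cut at the next part of \<open>\<mu>\<close>. Above the cut
  the weights are powers of \<open>y\<close> and adjoin the variable \<open>y\<close>; below it the
  weight is constant and adjoins a \<open>1\<close>. The boundary term at \<open>v\<close> thus has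
  one more \<open>1\<close> in its alphabet, as row \<open>Suc i\<close> has compared with row
  \<open>i\<close>.\<close>

lemma sum_jt_row_dual_grothendieck_branching:
  assumes \<mu>: "\<mu> \<in> partitions_of_length m"
  shows "(\<Sum>\<nu>\<in>bounded_partitions \<mu>.
      (\<Prod>i<m. y ^ (part \<mu> i - max (part \<nu> i) (part \<mu> (Suc i))))
        * row_det m (\<lambda>i. jt_row (replicate_mset i 1 + M) i (part \<nu> i)))
    = row_det m (\<lambda>i. jt_row (replicate_mset i 1 + add_mset y M) i (part \<mu> i))"
    (is "?lhs = _")
proof -
  define p where "p i = part \<mu> (Suc i)" for i
  \<comment> \<open>At the cut \<open>p i\<close> the two pieces leave boundary terms with alphabets
    that differ in \<open>y\<close> against \<open>1\<close>. By \<open>jt_row_diff\<close> their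
    difference is \<open>1 - y\<close> times the next row of the target matrix, whence the second
    summand.\<close>
  define s where "s i j = jt_row (replicate_mset i 1 + add_mset y M) i (part \<mu> i) j
    + y ^ (part \<mu> i - p i) * (1 - y) * jt_row (replicate_mset (Suc i) 1 + add_mset y M) (Suc i) (p i) j"
    for i j
  have "?lhs = row_det m s"
  proof (rule sum_bounded_partitions_row_det)
    show "length \<mu> = m" using \<mu> by (simp add: partitions_of_length_def)
    fix i v assume "v \<le> part \<mu> (Suc i)"
    then have v: "v \<le> p i" by (simp add: p_def)
    have p: "p i \<le> part \<mu> i" using part_antimono[OF \<mu>, of i "Suc i"] by (simp add: p_def)
    let ?N = "replicate_mset i 1 + M"
    have "(\<Sum>x=v..part \<mu> i. y ^ (part \<mu> i - max x (part \<mu> (Suc i))) * jt_row ?N i x j)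
        = s i j + (- (y ^ (part \<mu> i - p i))) * jt_row (replicate_mset (Suc i) 1 + M) (Suc i) v j"
      (is "?sum = _") for j
    proof -
      have "?sum = (\<Sum>x\<in>{v..p i} \<union> {Suc (p i)..part \<mu> i}. y ^ (part \<mu> i - max x (p i)) * jt_row ?N i x j)"
        by (rule sum.cong) (use v p in \<open>auto simp: p_def\<close>)
      also have "\<dots> = (\<Sum>x=v..p i. y ^ (part \<mu> i - max x (p i)) * jt_row ?N i x j)
          + (\<Sum>x=Suc (p i)..part \<mu> i. y ^ (part \<mu> i - max x (p i)) * jt_row ?N i x j)"
        by (rule sum.union_disjoint) auto
      also have "(\<Sum>x=v..p i. y ^ (part \<mu> i - max x (p i)) * jt_row ?N i x j)
          = y ^ (part \<mu> i - p i) * (\<Sum>x=v..p i. 1 ^ (p i - x) * jt_row ?N i x j)"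
        unfolding sum_distrib_left by (rule sum.cong) (auto simp: max_def)
      also have "(\<Sum>x=Suc (p i)..part \<mu> i. y ^ (part \<mu> i - max x (p i)) * jt_row ?N i x j)
          = (\<Sum>x=Suc (p i)..part \<mu> i. y ^ (part \<mu> i - x) * jt_row ?N i x j)"
        by (rule sum.cong) (auto simp: max_def)
      also have "\<dots> = jt_row (add_mset y ?N) i (part \<mu> i) j
          - y ^ (part \<mu> i - p i) * jt_row (add_mset y ?N) i (p i) j"
        \<comment> \<open>The sum starts at \<open>Suc (p i)\<close>, and row \<open>Suc i\<close>
          for this value has the same entries as row \<open>i\<close> for
          \<open>p i\<close>.\<close>
        using p by (subst sum_powers_jt_row) (auto simp: jt_row_def)
      also have "(\<Sum>x=v..p i. 1 ^ (p i - x) * jt_row ?N i x j)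
          = jt_row (add_mset 1 ?N) i (p i) j - jt_row (add_mset 1 ?N) (Suc i) v j"
        using v by (subst sum_powers_jt_row) auto
      also have "jt_row (add_mset 1 ?N) i (p i) j = jt_row (add_mset y ?N) i (p i) j
          + (1 - y) * jt_row (add_mset 1 (add_mset y ?N)) (Suc i) (p i) j"
        using jt_row_diff[of 1 ?N i "p i" j y] by (simp only: diff_eq_eq add.commute)
      finally show ?thesis
        by (simp add: s_def algebra_simps)
    qed
    then show "\<exists>c. \<forall>j<m.
        (\<Sum>x=v..part \<mu> i. y ^ (part \<mu> i - max x (part \<mu> (Suc i))) * jt_row ?N i x j)
          = s i j + c * jt_row (replicate_mset (Suc i) 1 + M) (Suc i) v j"
      by blast
  qed (simp add: jt_row_zero)
  also have "\<dots> = row_det m (\<lambda>i. jt_row (replicate_mset i 1 + add_mset y M) i (part \<mu> i))"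
  proof (rule row_det_bidiagonal)
    fix j assume "j < m"
    moreover have "part \<mu> m = 0" using \<mu> by (simp add: part_def partitions_of_length_def)
    ultimately show "jt_row (replicate_mset m 1 + add_mset y M) m (part \<mu> m) j = 0"
      by (simp add: jt_row_zero)
  qed (auto simp: s_def p_def)
  finally show ?thesis .
qed

text \<open>Summation with constant weight adjoins one \<open>1\<close> to every row, giving
  \<open>Suc i\<close> ones in row \<open>i\<close>. Row operations then raise all these numbers to
  \<open>m\<close>.\<close>

lemma sum_jt_row_rectangle:
  "(\<Sum>\<nu>\<in>bounded_partitions (replicate m a).
      row_det m (\<lambda>i. jt_row (replicate_mset i 1 + M) i (part \<nu> i)))
    = row_det m (\<lambda>i. jt_row (replicate_mset m 1 + M) i (part (replicate m a) i))"
proof -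
  have part: "part (replicate m a) i = (if i < m then a else 0)" for i
    by (simp add: part_def)
  \<comment> \<open>At least \<open>l\<close> ones in every row: \<open>t 0\<close> is the result of
    the summation and \<open>t m\<close> the target. The part \<open>0\<close> in row
    \<open>m\<close> makes that row vanish in the columns of the matrix.\<close>
  define t where "t l i = jt_row (replicate_mset (max (Suc i) l) 1 + M) i (if i < m then a else 0)"
    for l i
  have "(\<Sum>\<nu>\<in>bounded_partitions (replicate m a).
        (\<Prod>i<m. 1) * row_det m (\<lambda>i. jt_row (replicate_mset i 1 + M) i (part \<nu> i)))
      = row_det m (t 0)"
  proof (rule sum_bounded_partitions_row_det)
    fix i v assume "i < m" and "v \<le> part (replicate m a) (Suc i)"
    then have v: "v \<le> a" by (auto simp: part split: if_splits)
    have "(\<Sum>x=v..a. 1 ^ (a - x) * jt_row (replicate_mset i 1 + M) i x j) =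
        t 0 i j + (- 1) * jt_row (replicate_mset (Suc i) 1 + M) (Suc i) v j" for j
      using v \<open>i < m\<close> by (subst sum_powers_jt_row) (auto simp: t_def)
    then show "\<exists>c. \<forall>j<m.
        (\<Sum>x=v..part (replicate m a) i. 1 * jt_row (replicate_mset i 1 + M) i x j)
          = t 0 i j + c * jt_row (replicate_mset (Suc i) 1 + M) (Suc i) v j"
      using \<open>i < m\<close> by (intro exI[of _ "-1"]) (simp add: part)
  qed (simp_all add: jt_row_zero)
  also have "row_det m (t 0) = row_det m (t m)"
  proof -
    have "row_det m (t 0) = row_det m (t l)" if "l \<le> m" for l
      using that
    proof (induction l)
      case (Suc l)
      have "row_det m (t l) = row_det m (t (Suc l))"
      proof (rule row_det_bidiagonal)
        fix i assume "i < m"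
        show "\<exists>c. \<forall>j<m. t l i j = t (Suc l) i j + c * t (Suc l) (Suc i) j"
        proof (cases "i < l")
          case True
          then have i: "Suc i < m" "max (Suc i) l = l" "max (Suc i) (Suc l) = Suc l"
            "max (Suc (Suc i)) (Suc l) = Suc l"
            using Suc.prems by auto
          let ?N = "replicate_mset l 1 + M"
          \<comment> \<open>Passing from \<open>l\<close> to \<open>Suc l\<close> ones costs a term
            of lower degree. It is the entry of row \<open>Suc i\<close> because both rows have the
            same part \<open>a\<close>.\<close>
          have "jt_row ?N i a j = jt_row (add_mset 1 ?N) i a j - jt_row (add_mset 1 ?N) (Suc i) a j" for j
            using sum_powers_jt_row[of a a 1 ?N i j] by simp
          then have "\<forall>j<m. t l i j = t (Suc l) i j + (- 1) * t (Suc l) (Suc i) j"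
            using i \<open>i < m\<close> by (simp add: t_def)
          then show ?thesis by blast
        next
          case False
          then have "t l i j = t (Suc l) i j + 0 * t (Suc l) (Suc i) j" for j
            by (simp add: t_def max_def)
          then show ?thesis by blast
        qed
      qed (simp add: t_def jt_row_zero)
      then show ?case using Suc by simp
    qed simp
    from this[of m] show ?thesis by simp
  qed
  also have "\<dots> = row_det m (\<lambda>i. jt_row (replicate_mset m 1 + M) i (part (replicate m a) i))"
    by (rule row_det_cong) (auto simp: t_def part max_def)
  finally show ?thesis by simp
qed

section \<open>Dual Grothendieck polynomials\<close>

lemma lower_set_eq_lessThan_card:
  fixes S :: "nat set"
  assumes "finite S" and "\<And>j. Suc j \<in> S \<Longrightarrow> j \<in> S"
  shows "j \<in> S \<longleftrightarrow> j < card S"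
proof -
  have down: "j' \<in> S" if "j' \<le> j" "j \<in> S" for j j'
    using that by (induction j' rule: inc_induct) (auto intro: assms(2))
  show ?thesis
  proof
    assume "j \<in> S"
    then have "{..j} \<subseteq> S" using down by auto
    from card_mono[OF assms(1) this] show "j < card S" by simp
  next
    assume "j < card S"
    show "j \<in> S"
    proof (rule ccontr)
      assume "j \<notin> S"
      then have "S \<subseteq> {..<j}" using down by (force simp: not_less[symmetric])
      from card_mono[OF _ this] show False using \<open>j < card S\<close> by simp
    qed
  qed
qed

lemma ex_partition_with_parts:
  assumes "\<And>i. c (Suc i) \<le> c i" and "c m = (0::nat)"
  shows "\<exists>\<nu>\<in>partitions_of_length m. part \<nu> = c"
proof
  have anti: "c j \<le> c i" if "i \<le> j" for i j
    using lift_Suc_antimono_le[of c, OF assms(1) that] .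
  show "map c [0..<m] \<in> partitions_of_length m"
    by (auto simp: partitions_of_length_def sorted_wrt_iff_nth_less anti)
  show "part (map c [0..<m]) = c"
    using anti[of m] assms(2) by (fastforce simp: part_def fun_eq_iff not_less)
qed

lemma part_inject:
  assumes "\<mu> \<in> partitions_of_length m" "\<nu> \<in> partitions_of_length m" and "part \<mu> = part \<nu>"
  shows "\<mu> = \<nu>"
proof (rule nth_equalityI)
  fix i assume "i < length \<mu>"
  then show "\<mu> ! i = \<nu> ! i"
    using fun_cong[OF assms(3), of i] assms(1,2) by (simp add: part_def partitions_of_length_def)
qed (use assms in \<open>simp add: partitions_of_length_def\<close>)

lemma part_eq_0: "\<mu> \<in> partitions_of_length m \<Longrightarrow> m \<le> i \<Longrightarrow> part \<mu> i = 0"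
  by (simp add: part_def partitions_of_length_def)

lemma bounded_partitions_iff:
  assumes "\<mu> \<in> partitions_of_length m"
  shows "\<nu> \<in> bounded_partitions \<mu> \<longleftrightarrow>
    \<nu> \<in> partitions_of_length m \<and> (\<forall>i. part \<nu> i \<le> part \<mu> i)"
proof
  assume "\<nu> \<in> bounded_partitions \<mu>"
  then show "\<nu> \<in> partitions_of_length m \<and> (\<forall>i. part \<nu> i \<le> part \<mu> i)"
    using assms part_le_of_bounded_partitions[of \<nu> \<mu>]
    by (auto simp: bounded_partitions_def partitions_of_length_def)
next
  assume *: "\<nu> \<in> partitions_of_length m \<and> (\<forall>i. part \<nu> i \<le> part \<mu> i)"
  have "\<nu> ! i \<le> \<mu> ! i" if "i < m" for i
    using *[THEN conjunct2, rule_format, of i] that assms *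
    by (auto simp: part_def partitions_of_length_def)
  with * assms show "\<nu> \<in> bounded_partitions \<mu>"
    by (auto simp: bounded_partitions_def partitions_of_length_def)
qed

lemma plane_partitions_iff:
  "\<pi> \<in> plane_partitions \<mu> n \<longleftrightarrow>
     (\<forall>i j. 0 < \<pi> i j \<longleftrightarrow> j < part \<mu> i) \<and> (\<forall>i j. \<pi> i (Suc j) \<le> \<pi> i j) \<and>
     (\<forall>i j. \<pi> (Suc i) j \<le> \<pi> i j) \<and> (\<forall>i j. \<pi> i j \<le> n)"
    (is "_ \<longleftrightarrow> ?R")
proof
  assume "\<pi> \<in> plane_partitions \<mu> n"
  then show ?R
    using plane_partition_support[of \<pi> \<mu> n]
    by (auto simp: plane_partitions_def plane_partition_def cells_def)
next
  assume R: ?R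
  have "{(i, j). \<pi> i j \<noteq> 0} \<subseteq> cells \<mu>" using R by (auto simp: cells_def)
  then have "finite {(i, j). \<pi> i j \<noteq> 0}" using finite_cells finite_subset by blast
  with R show "\<pi> \<in> plane_partitions \<mu> n"
    by (simp add: plane_partitions_def plane_partition_def pp_shape_def fun_eq_iff)
qed

text \<open>The bookkeeping shared by both branching rules: \<open>down\<close> removes one letter
  from a filling, \<open>up\<close> restores it, and the shape left in between, determined by the
  filling, indexes the outer sum.\<close>

lemma sum_over_shapes:
  assumes "finite I" and "\<And>\<nu>. \<nu> \<in> I \<Longrightarrow> finite (B \<nu>)"
    and up: "\<And>\<nu> \<pi>. \<nu> \<in> I \<Longrightarrow> \<pi> \<in> B \<nu> \<Longrightarrow> up \<pi> \<in> A" "\<And>\<nu> \<pi>. \<nu> \<in> I \<Longrightarrow> \<pi> \<in> B \<nu> \<Longrightarrow> down (up \<pi>) = \<pi>"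
    and down: "\<And>\<pi>. \<pi> \<in> A \<Longrightarrow> up (down \<pi>) = \<pi>" "\<And>\<pi>. \<pi> \<in> A \<Longrightarrow> \<exists>\<nu>\<in>I. down \<pi> \<in> B \<nu>"
    and disj: "\<And>\<nu> \<nu>' \<pi>. \<nu> \<in> I \<Longrightarrow> \<nu>' \<in> I \<Longrightarrow> \<pi> \<in> B \<nu> \<Longrightarrow> \<pi> \<in> B \<nu>' \<Longrightarrow> \<nu> = \<nu>'"
  shows "sum F A = (\<Sum>\<nu>\<in>I. \<Sum>\<pi>\<in>B \<nu>. F (up \<pi>))"
proof -
  have "bij_betw (\<lambda>(\<nu>, \<pi>). up \<pi>) (Sigma I B) A"
  proof (rule bij_betw_imageI)
    show "inj_on (\<lambda>(\<nu>, \<pi>). up \<pi>) (Sigma I B)"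
    proof (intro inj_onI, clarsimp)
      fix \<nu> \<pi> \<nu>' \<pi>' assume *: "\<nu> \<in> I" "\<pi> \<in> B \<nu>" "\<nu>' \<in> I" "\<pi>' \<in> B \<nu>'" "up \<pi> = up \<pi>'"
      then have "\<pi> = \<pi>'" using up(2) by metis
      with * disj show "\<nu> = \<nu>' \<and> \<pi> = \<pi>'" by blast
    qed
    show "(\<lambda>(\<nu>, \<pi>). up \<pi>) ` Sigma I B = A"
    proof
      show "A \<subseteq> (\<lambda>(\<nu>, \<pi>). up \<pi>) ` Sigma I B"
      proof
        fix \<pi> assume \<pi>: "\<pi> \<in> A"
        with down(2) obtain \<nu> where "\<nu> \<in> I" "down \<pi> \<in> B \<nu>" by blast
        then show "\<pi> \<in> (\<lambda>(\<nu>, \<pi>). up \<pi>) ` Sigma I B"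
          using down(1)[OF \<pi>] by (intro image_eqI[of _ _ "(\<nu>, down \<pi>)"]) auto
      qed
    qed (use up(1) in auto)
  qed
  then have "sum F A = (\<Sum>x\<in>Sigma I B. F ((\<lambda>(\<nu>, \<pi>). up \<pi>) x))"
    by (rule sum.reindex_bij_betw[symmetric])
  also have "\<dots> = (\<Sum>(\<nu>, \<pi>)\<in>Sigma I B. F (up \<pi>))"
    by (simp add: case_prod_unfold)
  finally show ?thesis
    using assms(1,2) by (simp add: sum.Sigma)
qed

section \<open>The branching rule of plane partitions: removal of the ones\<close>

definition raise_entries :: "nat list \<Rightarrow> (nat \<Rightarrow> nat \<Rightarrow> nat) \<Rightarrow> nat \<Rightarrow> nat \<Rightarrow> nat" where
  "raise_entries \<mu> \<pi> i j = (if j < part \<mu> i then Suc (\<pi> i j) else 0)"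

lemma sum_plane_partitions_Suc:
  assumes \<mu>: "\<mu> \<in> partitions_of_length m"
  shows "sum F (plane_partitions \<mu> (Suc n)) =
    (\<Sum>\<nu>\<in>bounded_partitions \<mu>. \<Sum>\<pi>\<in>plane_partitions \<nu> n. F (raise_entries \<mu> \<pi>))"
proof (rule sum_over_shapes[where down = "\<lambda>\<pi> i j. \<pi> i j - 1"])
  fix \<nu> \<pi> assume \<nu>: "\<nu> \<in> bounded_partitions \<mu>" and \<pi>: "\<pi> \<in> plane_partitions \<nu> n"
  from \<pi> have pp: "\<And>i j. 0 < \<pi> i j \<longleftrightarrow> j < part \<nu> i" "\<And>i j. \<pi> i (Suc j) \<le> \<pi> i j"
      "\<And>i j. \<pi> (Suc i) j \<le> \<pi> i j" "\<And>i j. \<pi> i j \<le> n"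
    by (auto simp: plane_partitions_iff)
  have le: "part \<nu> i \<le> part \<mu> i" for i using \<nu> bounded_partitions_iff[OF \<mu>] by auto
  have mono: "part \<mu> (Suc i) \<le> part \<mu> i" for i by (rule part_antimono[OF \<mu>]) simp
  show "raise_entries \<mu> \<pi> \<in> plane_partitions \<mu> (Suc n)"
    unfolding plane_partitions_iff raise_entries_def
    using pp order.strict_trans2[OF _ mono] by auto
  show "(\<lambda>i j. raise_entries \<mu> \<pi> i j - 1) = \<pi>"
  proof (intro ext)
    fix i j
    show "raise_entries \<mu> \<pi> i j - 1 = \<pi> i j"
      using pp(1)[of i j] le[of i] by (auto simp: raise_entries_def)
  qed
next
  fix \<pi> assume "\<pi> \<in> plane_partitions \<mu> (Suc n)"
  then have pp: "\<And>i j. 0 < \<pi> i j \<longleftrightarrow> j < part \<mu> i" "\<And>i j. \<pi> i (Suc j) \<le> \<pi> i j"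
      "\<And>i j. \<pi> (Suc i) j \<le> \<pi> i j" "\<And>i j. \<pi> i j \<le> Suc n"
    by (auto simp: plane_partitions_iff)
  show "raise_entries \<mu> (\<lambda>i j. \<pi> i j - 1) = \<pi>"
  proof (intro ext)
    fix i j
    show "raise_entries \<mu> (\<lambda>i j. \<pi> i j - 1) i j = \<pi> i j"
      using pp(1)[of i j] by (auto simp: raise_entries_def)
  qed
  \<comment> \<open>The row lengths of the remaining shape. Since rows decrease weakly, the entries
    above \<open>1\<close> form an initial segment of row \<open>i\<close>.\<close>
  define c where "c i = card {j. 1 < \<pi> i j}" for i
  have sub: "{j. 1 < \<pi> i j} \<subseteq> {..<part \<mu> i}" for i
  proof
    fix j assume "j \<in> {j. 1 < \<pi> i j}"
    then show "j \<in> {..<part \<mu> i}" using pp(1)[of i j] by simp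
  qed
  then have fin: "finite {j. 1 < \<pi> i j}" for i using finite_subset by blast
  have c: "1 < \<pi> i j \<longleftrightarrow> j < c i" for i j
    using lower_set_eq_lessThan_card[OF fin[of i], of j] order.strict_trans2[OF _ pp(2)[of i]]
    by (simp add: c_def)
  have c_le: "c i \<le> part \<mu> i" for i
    using card_mono[OF _ sub[of i]] by (simp add: c_def)
  have c_Suc: "c (Suc i) \<le> c i" for i
    unfolding c_def by (rule card_mono[OF fin]) (use order.strict_trans2[OF _ pp(3)] in auto)
  have "c m = 0" using c_le[of m] part_eq_0[OF \<mu>, of m] by simp
  from ex_partition_with_parts[of c, OF c_Suc this]
  obtain \<nu> where \<nu>: "\<nu> \<in> partitions_of_length m" "part \<nu> = c" by blast
  show "\<exists>\<nu>\<in>bounded_partitions \<mu>. (\<lambda>i j. \<pi> i j - 1) \<in> plane_partitions \<nu> n"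
  proof
    show "\<nu> \<in> bounded_partitions \<mu>" using \<nu> c_le by (simp add: bounded_partitions_iff[OF \<mu>])
    show "(\<lambda>i j. \<pi> i j - 1) \<in> plane_partitions \<nu> n"
      unfolding plane_partitions_iff \<nu>(2)
    proof (intro conjI allI)
      fix i j
      show "0 < \<pi> i j - 1 \<longleftrightarrow> j < c i" using c[of i j] by simp
      show "\<pi> i j - 1 \<le> n" using pp(4)[of i j] by simp
    qed (simp_all add: pp(2,3) diff_le_mono)
  qed
next
  fix \<nu> \<nu>' \<pi>
  assume *: "\<nu> \<in> bounded_partitions \<mu>" "\<nu>' \<in> bounded_partitions \<mu>"
    "\<pi> \<in> plane_partitions \<nu> n" "\<pi> \<in> plane_partitions \<nu>' n"
  have "j < part \<nu> i \<longleftrightarrow> j < part \<nu>' i" for i j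
    using *(3,4)[unfolded plane_partitions_iff, THEN conjunct1, rule_format, of i j] by simp
  then have "part \<nu> i = part \<nu>' i" for i using linorder_neqE_nat[of "part \<nu> i" "part \<nu>' i"] by blast
  then have "part \<nu> = part \<nu>'" by auto
  then show "\<nu> = \<nu>'" using * by (auto simp: bounded_partitions_iff[OF \<mu>] intro: part_inject)
qed (auto simp: finite_plane_partitions)

lemma columns_containing_raise_entries_Suc:
  assumes "\<mu> \<in> partitions_of_length m" "\<nu> \<in> bounded_partitions \<mu>" "\<pi> \<in> plane_partitions \<nu> n"
    and "0 < v"
  shows "columns_containing (raise_entries \<mu> \<pi>) (Suc v) = columns_containing \<pi> v"
proof -
  have "raise_entries \<mu> \<pi> i j = Suc v \<longleftrightarrow> \<pi> i j = v" for i j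
  proof -
    have "0 < \<pi> i j \<longleftrightarrow> j < part \<nu> i" and "part \<nu> i \<le> part \<mu> i"
      using assms(3) assms(2) bounded_partitions_iff[OF assms(1)] by (auto simp: plane_partitions_iff)
    then show ?thesis using \<open>0 < v\<close> by (auto simp: raise_entries_def)
  qed
  then show ?thesis by (simp add: columns_containing_def)
qed

text \<open>Column \<open>j\<close> contains a \<open>1\<close> if and only if its lowest positive entry is \<open>1\<close>.\<close>

lemma columns_containing_raise_entries_1:
  assumes \<mu>: "\<mu> \<in> partitions_of_length m" and \<nu>: "\<nu> \<in> bounded_partitions \<mu>"
    and \<pi>: "\<pi> \<in> plane_partitions \<nu> n"
  shows "columns_containing (raise_entries \<mu> \<pi>) 1 =
    (\<Sum>i<m. part \<mu> i - max (part \<nu> i) (part \<mu> (Suc i)))"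
proof -
  have \<nu>': "\<nu> \<in> partitions_of_length m" using \<nu> by (simp add: bounded_partitions_iff[OF \<mu>])
  let ?C = "\<lambda>i. {max (part \<nu> i) (part \<mu> (Suc i))..<part \<mu> i}"
  have one: "raise_entries \<mu> \<pi> i j = 1 \<longleftrightarrow> part \<nu> i \<le> j \<and> j < part \<mu> i" for i j
  proof -
    have "0 < \<pi> i j \<longleftrightarrow> j < part \<nu> i" using \<pi> by (auto simp: plane_partitions_iff)
    then show ?thesis by (auto simp: raise_entries_def)
  qed
  have "{j. \<exists>i. raise_entries \<mu> \<pi> i j = 1} = (\<Union>i<m. ?C i)"
  proof (intro equalityI subsetI)
    fix j assume "j \<in> {j. \<exists>i. raise_entries \<mu> \<pi> i j = 1}"
    then obtain i where i: "part \<nu> i \<le> j" "j < part \<mu> i" using one by auto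
    \<comment> \<open>Go down column \<open>j\<close> from row \<open>i\<close>: \<open>l\<close> is
      the first offset outside the diagram of \<open>\<mu>\<close>, so \<open>i + l'\<close> is the
      lowest row inside, and its entry is still \<open>1\<close>.\<close>
    have "\<exists>l. part \<mu> (i + l) \<le> j"
      using part_eq_0[OF \<mu>, of "i + m"] by (intro exI[of _ m]) simp
    then obtain l where l: "part \<mu> (i + l) \<le> j" and least: "\<And>l'. l' < l \<Longrightarrow> \<not> part \<mu> (i + l') \<le> j"
      using exists_least_iff[of "\<lambda>l. part \<mu> (i + l) \<le> j"] by blast
    with i obtain l' where l': "l = Suc l'" by (cases l) auto
    have lt: "j < part \<mu> (i + l')" using least[of l'] l' by simp
    moreover have "part \<nu> (i + l') \<le> j" using part_antimono[OF \<nu>', of i "i + l'"] i by simp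
    moreover have "i + l' < m" using lt part_eq_0[OF \<mu>, of "i + l'"] by (cases "i + l' < m") auto
    ultimately show "j \<in> (\<Union>i<m. ?C i)" using l l' by (intro UN_I[of "i + l'"]) auto
  qed (use one in auto)
  moreover have "card (\<Union>i<m. ?C i) = (\<Sum>i<m. card (?C i))"
  proof (rule card_UN_disjoint)
    show "\<forall>i\<in>{..<m}. \<forall>i'\<in>{..<m}. i \<noteq> i' \<longrightarrow> ?C i \<inter> ?C i' = {}"
    proof -
      have "?C i \<inter> ?C i' = {}" if "i < i'" for i i'
        using part_antimono[OF \<mu>, of "Suc i" i'] that by auto
      then show ?thesis by (metis Int_commute linorder_neqE_nat)
    qed
  qed auto
  ultimately show ?thesis by (simp add: columns_containing_def)
qed

text \<open>The head \<open>x\<close> belongs to the entry \<open>1\<close>. Subtracting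
  \<open>1\<close> from all positive entries shifts the other variables down by one place.\<close>

lemma dual_grothendieck_Cons:
  assumes \<mu>: "\<mu> \<in> partitions_of_length m"
  shows "dual_grothendieck \<mu> (x # xs) =
    (\<Sum>\<nu>\<in>bounded_partitions \<mu>.
      (\<Prod>i<m. x ^ (part \<mu> i - max (part \<nu> i) (part \<mu> (Suc i)))) * dual_grothendieck \<nu> xs)"
proof -
  have "(\<Prod>v=1..Suc (length xs). ((x # xs) ! (v - 1)) ^ columns_containing (raise_entries \<mu> \<pi>) v)
      = (\<Prod>i<m. x ^ (part \<mu> i - max (part \<nu> i) (part \<mu> (Suc i)))) *
        (\<Prod>v=1..length xs. (xs ! (v - 1)) ^ columns_containing \<pi> v)"
    if \<nu>: "\<nu> \<in> bounded_partitions \<mu>" and \<pi>: "\<pi> \<in> plane_partitions \<nu> (length xs)" for \<nu> \<pi>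
  proof -
    have "(\<Prod>v=1..Suc (length xs). ((x # xs) ! (v - 1)) ^ columns_containing (raise_entries \<mu> \<pi>) v)
      = x ^ columns_containing (raise_entries \<mu> \<pi>) 1 *
        (\<Prod>v=1..length xs. ((x # xs) ! v) ^ columns_containing (raise_entries \<mu> \<pi>) (Suc v))"
      by (simp add: prod.atLeast1_atMost_eq prod.lessThan_Suc_shift
          del: prod.lessThan_Suc prod.cl_ivl_Suc)
    also have "(\<Prod>v=1..length xs. ((x # xs) ! v) ^ columns_containing (raise_entries \<mu> \<pi>) (Suc v))
        = (\<Prod>v=1..length xs. (xs ! (v - 1)) ^ columns_containing \<pi> v)"
      by (rule prod.cong) (auto simp: columns_containing_raise_entries_Suc[OF \<mu> \<nu> \<pi>])
    finally show ?thesis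
      by (simp add: columns_containing_raise_entries_1[OF \<mu> \<nu> \<pi>, simplified] power_sum)
  qed
  then show ?thesis
    by (simp add: dual_grothendieck_def sum_plane_partitions_Suc[OF \<mu>] sum_distrib_left)
qed

lemma dual_grothendieck_Nil:
  "dual_grothendieck \<mu> [] = (if \<forall>i. part \<mu> i = 0 then 1 else 0)"
proof -
  have "plane_partitions \<mu> 0 = (if \<forall>i. part \<mu> i = 0 then {\<lambda>_ _. 0} else {})"
    by (auto simp: plane_partitions_iff fun_eq_iff)
  then show ?thesis by (simp add: dual_grothendieck_def)
qed

text \<open>Polynomial and determinant obey the same branching rule and agree when there are no
  variables.\<close>

theorem dual_grothendieck_jacobi_trudi:
  assumes "\<mu> \<in> partitions_of_length m"
  shows "dual_grothendieck \<mu> xs =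
    row_det m (\<lambda>i. jt_row (replicate_mset i 1 + mset xs) i (part \<mu> i))"
  using assms
proof (induction xs arbitrary: \<mu>)
  case Nil
  then show ?case by (simp add: dual_grothendieck_Nil row_det_jt_row_empty)
next
  case (Cons x xs)
  have "dual_grothendieck \<nu> xs = row_det m (\<lambda>i. jt_row (replicate_mset i 1 + mset xs) i (part \<nu> i))"
    if "\<nu> \<in> bounded_partitions \<mu>" for \<nu>
    using that Cons by (simp add: bounded_partitions_iff)
  then show ?case
    using sum_jt_row_dual_grothendieck_branching[OF Cons.prems, of x "mset xs"]
    by (simp add: dual_grothendieck_Cons[OF Cons.prems])
qed

section \<open>Schur polynomials\<close>

lemma ssyt_iff:
  "T \<in> ssyt \<mu> N \<longleftrightarrow>
     (\<forall>i j. 0 < T i j \<longleftrightarrow> j < part \<mu> i) \<and> (\<forall>i j. T i j \<le> N) \<and>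
     (\<forall>i j. Suc j < part \<mu> i \<longrightarrow> T i j \<le> T i (Suc j)) \<and>
     (\<forall>i j. j < part \<mu> (Suc i) \<longrightarrow> T i j < T (Suc i) j)"
proof -
  have "(\<forall>i j. (i, j) \<in> cells \<mu> \<longrightarrow> T i j \<in> {1..N}) \<and> (\<forall>i j. (i, j) \<notin> cells \<mu> \<longrightarrow> T i j = 0) \<longleftrightarrow>
      (\<forall>i j. 0 < T i j \<longleftrightarrow> j < part \<mu> i) \<and> (\<forall>i j. T i j \<le> N)"
    by (simp add: cells_def Suc_le_eq) (metis gr0I less_numeral_extra(3) zero_le)
  then show ?thesis by (auto simp: ssyt_def cells_def)
qed

section \<open>The branching rule of semistandard tableaux: removal of the largest letter\<close>

definition fill_with :: "nat \<Rightarrow> nat list \<Rightarrow> (nat \<Rightarrow> nat \<Rightarrow> nat) \<Rightarrow> nat \<Rightarrow> nat \<Rightarrow> nat" where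
  "fill_with N \<mu> T i j = (if j < part \<mu> i \<and> T i j = 0 then N else T i j)"

text \<open>Those \<open>\<nu>\<close> for which the skew diagram of \<open>\<mu>\<close> by
  \<open>\<nu>\<close> is a horizontal strip, for \<open>\<mu>\<close> a partition.\<close>

definition interlacing_partitions :: "nat list \<Rightarrow> nat list set" where
  "interlacing_partitions \<mu> = {\<nu> \<in> bounded_partitions \<mu>. \<forall>i. part \<mu> (Suc i) \<le> part \<nu> i}"

lemma sum_ssyt_Suc:
  assumes \<mu>: "\<mu> \<in> partitions_of_length m"
  shows "sum F (ssyt \<mu> (Suc N)) =
    (\<Sum>\<nu>\<in>interlacing_partitions \<mu>. \<Sum>T\<in>ssyt \<nu> N. F (fill_with (Suc N) \<mu> T))"
proof (rule sum_over_shapes[where down = "\<lambda>T i j. if T i j \<le> N then T i j else 0"])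
  fix \<nu> T assume \<nu>: "\<nu> \<in> interlacing_partitions \<mu>" and T: "T \<in> ssyt \<nu> N"
  have le: "part \<nu> i \<le> part \<mu> i" and ge: "part \<mu> (Suc i) \<le> part \<nu> i" for i
    using \<nu> bounded_partitions_iff[OF \<mu>] by (auto simp: interlacing_partitions_def)
  from T have T: "\<And>i j. 0 < T i j \<longleftrightarrow> j < part \<nu> i" "\<And>i j. T i j \<le> N"
      "\<And>i j. Suc j < part \<nu> i \<Longrightarrow> T i j \<le> T i (Suc j)"
      "\<And>i j. j < part \<nu> (Suc i) \<Longrightarrow> T i j < T (Suc i) j"
    by (auto simp: ssyt_iff)
  have fill: "fill_with (Suc N) \<mu> T i j =
      (if j < part \<nu> i then T i j else if j < part \<mu> i then Suc N else 0)" for i j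
    using T(1)[of i j] le[of i] by (auto simp: fill_with_def)
  show "fill_with (Suc N) \<mu> T \<in> ssyt \<mu> (Suc N)"
    unfolding ssyt_iff
  proof (intro conjI allI impI)
    fix i j
    show "0 < fill_with (Suc N) \<mu> T i j \<longleftrightarrow> j < part \<mu> i"
      using T(1)[of i j] le[of i] by (auto simp: fill)
    show "fill_with (Suc N) \<mu> T i j \<le> Suc N"
      using T(2)[of i j] by (auto simp: fill)
    show "fill_with (Suc N) \<mu> T i j \<le> fill_with (Suc N) \<mu> T i (Suc j)" if "Suc j < part \<mu> i"
      using that T(2)[of i j] T(3)[of j i] by (auto simp: fill)
    show "fill_with (Suc N) \<mu> T i j < fill_with (Suc N) \<mu> T (Suc i) j" if "j < part \<mu> (Suc i)"
      using that T(2)[of i j] T(4)[of j i] ge[of i] by (auto simp: fill)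
  qed
  show "(\<lambda>i j. if fill_with (Suc N) \<mu> T i j \<le> N then fill_with (Suc N) \<mu> T i j else 0) = T"
  proof (intro ext)
    fix i j
    show "(if fill_with (Suc N) \<mu> T i j \<le> N then fill_with (Suc N) \<mu> T i j else 0) = T i j"
      using T(1)[of i j] T(2)[of i j] by (auto simp: fill)
  qed
next
  fix T assume "T \<in> ssyt \<mu> (Suc N)"
  then have T: "\<And>i j. 0 < T i j \<longleftrightarrow> j < part \<mu> i" "\<And>i j. T i j \<le> Suc N"
      "\<And>i j. Suc j < part \<mu> i \<Longrightarrow> T i j \<le> T i (Suc j)"
      "\<And>i j. j < part \<mu> (Suc i) \<Longrightarrow> T i j < T (Suc i) j"
    by (auto simp: ssyt_iff)
  let ?T = "\<lambda>i j. if T i j \<le> N then T i j else 0"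
  show "fill_with (Suc N) \<mu> ?T = T"
  proof (intro ext)
    fix i j
    show "fill_with (Suc N) \<mu> ?T i j = T i j"
      using T(1)[of i j] T(2)[of i j] by (auto simp: fill_with_def)
  qed
  define c where "c i = card {j. j < part \<mu> i \<and> T i j \<le> N}" for i
  have fin: "finite {j. j < part \<mu> i \<and> T i j \<le> N}" for i by simp
  have c: "j < part \<mu> i \<and> T i j \<le> N \<longleftrightarrow> j < c i" for i j
  proof -
    have "j \<in> {j. j < part \<mu> i \<and> T i j \<le> N}" if "Suc j \<in> {j. j < part \<mu> i \<and> T i j \<le> N}" for j
      using that T(3)[of j i] by simp
    from lower_set_eq_lessThan_card[OF fin[of i] this, of j] show ?thesis
      by (simp only: c_def mem_Collect_eq)
  qed
  have c_le: "c i \<le> part \<mu> i" for i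
    using c[of "part \<mu> i" i] by simp
  \<comment> \<open>Otherwise the first cell of row \<open>i\<close> with the letter
    \<open>Suc N\<close> would have a cell below it, whose entry would have to exceed
    \<open>Suc N\<close>.\<close>
  have c_ge: "part \<mu> (Suc i) \<le> c i" for i
  proof (rule ccontr)
    assume "\<not> part \<mu> (Suc i) \<le> c i"
    then have "c i < part \<mu> (Suc i)" by simp
    then show False
      using T(4)[of "c i" i] T(2)[of "Suc i" "c i"] c[of "c i" i]
        part_antimono[OF \<mu>, of i "Suc i"] by auto
  qed
  have c_Suc: "c (Suc i) \<le> c i" for i using c_le[of "Suc i"] c_ge[of i] by simp
  have "c m = 0" using c_le[of m] part_eq_0[OF \<mu>, of m] by simp
  from ex_partition_with_parts[of c, OF c_Suc this]
  obtain \<nu> where \<nu>: "\<nu> \<in> partitions_of_length m" "part \<nu> = c" by blast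
  show "\<exists>\<nu>\<in>interlacing_partitions \<mu>. ?T \<in> ssyt \<nu> N"
  proof
    show "\<nu> \<in> interlacing_partitions \<mu>"
      using \<nu> c_le c_ge by (simp add: bounded_partitions_iff[OF \<mu>] interlacing_partitions_def)
    show "?T \<in> ssyt \<nu> N"
      unfolding ssyt_iff \<nu>(2)
    proof (intro conjI allI impI)
      fix i j
      show "0 < ?T i j \<longleftrightarrow> j < c i" using c[of j i] T(1)[of i j] by auto
      show "?T i j \<le> ?T i (Suc j)" if "Suc j < c i"
        using that c[of "Suc j" i] T(3)[of j i] by auto
      show "?T i j < ?T (Suc i) j" if "j < c (Suc i)"
        using that c[of j "Suc i"] T(4)[of j i] by auto
    qed auto
  qed
next
  fix \<nu> \<nu>' T
  assume *: "\<nu> \<in> interlacing_partitions \<mu>" "\<nu>' \<in> interlacing_partitions \<mu>"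
    "T \<in> ssyt \<nu> N" "T \<in> ssyt \<nu>' N"
  have "j < part \<nu> i \<longleftrightarrow> j < part \<nu>' i" for i j
    using *(3,4)[unfolded ssyt_iff, THEN conjunct1, rule_format, of i j] by simp
  then have "part \<nu> i = part \<nu>' i" for i using linorder_neqE_nat[of "part \<nu> i" "part \<nu>' i"] by blast
  then have "part \<nu> = part \<nu>'" by auto
  then show "\<nu> = \<nu>'" using *
    by (auto simp: bounded_partitions_iff[OF \<mu>] interlacing_partitions_def intro: part_inject)
qed (auto simp: finite_ssyt interlacing_partitions_def)

lemma prod_cells:
  assumes "\<mu> \<in> partitions_of_length m"
  shows "(\<Prod>(i, j)\<in>cells \<mu>. f i j) = (\<Prod>i<m. \<Prod>j<part \<mu> i. f i j)"
proof -
  have "i < m" if "j < part \<mu> i" for i j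
    using that part_eq_0[OF assms, of i] by (cases "i < m") auto
  then have "cells \<mu> = (SIGMA i:{..<m}. {..<part \<mu> i})"
    by (auto simp: cells_def)
  then show ?thesis by (simp add: prod.Sigma)
qed

text \<open>The last variable belongs to the largest letter, which occupies a horizontal strip.
  Writing the strip condition as a factor for each row extends the sum to all of
  \<open>bounded_partitions \<mu>\<close>, the form in which determinants are summed.\<close>

lemma schur_snoc:
  fixes y :: "'a::comm_semiring_1"
  assumes \<mu>: "\<mu> \<in> partitions_of_length m"
  shows "schur \<mu> (xs @ [y]) =
    (\<Sum>\<nu>\<in>bounded_partitions \<mu>.
      (\<Prod>i<m. if part \<mu> (Suc i) \<le> part \<nu> i then y ^ (part \<mu> i - part \<nu> i) else 0) * schur \<nu> xs)"
    (is "_ = (\<Sum>\<nu>\<in>_. ?w \<nu> * _)")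
proof -
  let ?N = "length xs"
  have weight: "(\<Prod>(i, j)\<in>cells \<mu>. (xs @ [y]) ! (fill_with (Suc ?N) \<mu> T i j - 1))
      = ?w \<nu> * (\<Prod>(i, j)\<in>cells \<nu>. xs ! (T i j - 1))"
    if \<nu>: "\<nu> \<in> interlacing_partitions \<mu>" and T: "T \<in> ssyt \<nu> ?N" for \<nu> T
  proof -
    have \<nu>': "\<nu> \<in> partitions_of_length m" and le: "part \<nu> i \<le> part \<mu> i"
      and ge: "part \<mu> (Suc i) \<le> part \<nu> i" for i
      using \<nu> bounded_partitions_iff[OF \<mu>] by (auto simp: interlacing_partitions_def)
    have row: "(\<Prod>j<part \<mu> i. (xs @ [y]) ! (fill_with (Suc ?N) \<mu> T i j - 1))
        = y ^ (part \<mu> i - part \<nu> i) * (\<Prod>j<part \<nu> i. xs ! (T i j - 1))" for i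
    proof -
      have T': "0 < T i j \<longleftrightarrow> j < part \<nu> i" "T i j \<le> ?N" for j using T by (auto simp: ssyt_iff)
      have "{..<part \<mu> i} = {..<part \<nu> i} \<union> {part \<nu> i..<part \<mu> i}" using le[of i] by auto
      then have "(\<Prod>j<part \<mu> i. (xs @ [y]) ! (fill_with (Suc ?N) \<mu> T i j - 1))
          = (\<Prod>j<part \<nu> i. (xs @ [y]) ! (fill_with (Suc ?N) \<mu> T i j - 1))
            * (\<Prod>j=part \<nu> i..<part \<mu> i. (xs @ [y]) ! (fill_with (Suc ?N) \<mu> T i j - 1))"
        by (simp add: prod.union_disjoint ivl_disj_int)
      also have "(\<Prod>j<part \<nu> i. (xs @ [y]) ! (fill_with (Suc ?N) \<mu> T i j - 1))
          = (\<Prod>j<part \<nu> i. xs ! (T i j - 1))"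
      proof (rule prod.cong)
        fix j assume "j \<in> {..<part \<nu> i}"
        then have "0 < T i j" "T i j - 1 < ?N" using T'[of j] by auto
        then show "(xs @ [y]) ! (fill_with (Suc ?N) \<mu> T i j - 1) = xs ! (T i j - 1)"
          by (simp add: fill_with_def nth_append)
      qed simp
      also have "(\<Prod>j=part \<nu> i..<part \<mu> i. (xs @ [y]) ! (fill_with (Suc ?N) \<mu> T i j - 1))
          = (\<Prod>j=part \<nu> i..<part \<mu> i. y)"
      proof (rule prod.cong)
        fix j assume "j \<in> {part \<nu> i..<part \<mu> i}"
        then have "T i j = 0" "j < part \<mu> i" using T'(1)[of j] by auto
        then show "(xs @ [y]) ! (fill_with (Suc ?N) \<mu> T i j - 1) = y"
          by (simp add: fill_with_def)
      qed simp
      finally show ?thesis by (simp add: mult.commute)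
    qed
    show ?thesis
      unfolding prod_cells[OF \<mu>] prod_cells[OF \<nu>'] row using ge by (simp add: prod.distrib)
  qed
  have "schur \<mu> (xs @ [y]) = (\<Sum>\<nu>\<in>interlacing_partitions \<mu>. ?w \<nu> * schur \<nu> xs)"
    using weight by (simp add: schur_def sum_ssyt_Suc[OF \<mu>] sum_distrib_left)
  also have "\<dots> = (\<Sum>\<nu>\<in>bounded_partitions \<mu>. ?w \<nu> * schur \<nu> xs)"
  proof (rule sum.mono_neutral_left)
    show "\<forall>\<nu>\<in>bounded_partitions \<mu> - interlacing_partitions \<mu>. ?w \<nu> * schur \<nu> xs = 0"
    proof
      fix \<nu> assume "\<nu> \<in> bounded_partitions \<mu> - interlacing_partitions \<mu>"
      then obtain i where i: "\<not> part \<mu> (Suc i) \<le> part \<nu> i"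
        by (auto simp: interlacing_partitions_def)
      then have "i < m" using part_eq_0[OF \<mu>, of "Suc i"] by (cases "i < m") auto
      with i have "?w \<nu> = 0" by (intro prod_zero) auto
      then show "?w \<nu> * schur \<nu> xs = 0" by simp
    qed
  qed (auto simp: interlacing_partitions_def)
  finally show ?thesis .
qed

lemma schur_Nil: "schur \<mu> [] = (if \<forall>i. part \<mu> i = 0 then 1 else 0)"
proof -
  have "ssyt \<mu> 0 = (if \<forall>i. part \<mu> i = 0 then {\<lambda>_ _. 0} else {})"
    by (auto simp: ssyt_iff fun_eq_iff)
  moreover have "cells \<mu> = {}" if "\<forall>i. part \<mu> i = 0"
    using that by (simp add: cells_def)
  ultimately show ?thesis by (auto simp: schur_def)
qed

text \<open>The induction removes variables from the end, because branching removes the largest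
  letter.\<close>

theorem schur_jacobi_trudi:
  assumes "\<mu> \<in> partitions_of_length m"
  shows "schur \<mu> xs = row_det m (\<lambda>i. jt_row (mset xs) i (part \<mu> i))"
  using assms
proof (induction xs arbitrary: \<mu> rule: rev_induct)
  case Nil
  then show ?case by (simp add: schur_Nil row_det_jt_row_empty)
next
  case (snoc y xs)
  have "schur \<nu> xs = row_det m (\<lambda>i. jt_row (mset xs) i (part \<nu> i))"
    if "\<nu> \<in> bounded_partitions \<mu>" for \<nu>
    using that snoc by (simp add: bounded_partitions_iff)
  then show ?case
    using sum_jt_row_schur_branching[OF snoc.prems, of y "mset xs"]
    by (simp add: schur_snoc[OF snoc.prems])
qed

theorem sum_dual_grothendieck_rectangle:
  fixes xs :: "'a::field list"
  shows "(\<Sum>\<nu>\<in>bounded_partitions (replicate m a). dual_grothendieck \<nu> xs) =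
     schur (replicate m a) (replicate m 1 @ xs)"
proof -
  have rect: "replicate m a \<in> partitions_of_length m"
    by (simp add: partitions_of_length_def sorted_wrt_iff_nth_less)
  have "(\<Sum>\<nu>\<in>bounded_partitions (replicate m a). dual_grothendieck \<nu> xs) =
      (\<Sum>\<nu>\<in>bounded_partitions (replicate m a).
        row_det m (\<lambda>i. jt_row (replicate_mset i 1 + mset xs) i (part \<nu> i)))"
    by (rule sum.cong)
      (auto simp: bounded_partitions_iff[OF rect] dual_grothendieck_jacobi_trudi)
  also have "\<dots> = row_det m (\<lambda>i. jt_row (replicate_mset m 1 + mset xs) i (part (replicate m a) i))"
    by (rule sum_jt_row_rectangle)
  also have "\<dots> = schur (replicate m a) (replicate m 1 @ xs)"
    by (simp add: schur_jacobi_trudi[OF rect])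
  finally show ?thesis .
qed

section \<open>Unbounded leading parts\<close>

lemma dual_grothendieck_nonneg:
  fixes xs :: "real list"
  assumes "\<forall>x\<in>set xs. 0 \<le> x"
  shows "0 \<le> dual_grothendieck \<mu> xs"
  unfolding dual_grothendieck_def
  by (intro sum_nonneg prod_nonneg ballI zero_le_power) (use assms in auto)

text \<open>Tonelli's argument: nonnegative terms turn iterated sums into summability over the
  pairs.\<close>

lemma has_sum_SigmaI_nonneg:
  fixes f :: "'a \<times> 'b \<Rightarrow> real"
  assumes "\<And>x. x \<in> A \<Longrightarrow> ((\<lambda>y. f (x, y)) has_sum g x) (B x)" and "(g has_sum S) A"
    and "\<And>x y. x \<in> A \<Longrightarrow> y \<in> B x \<Longrightarrow> 0 \<le> f (x, y)"
  shows "(f has_sum S) (Sigma A B)"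
proof (rule has_sum_SigmaI[OF assms(1,2)])
  show "f summable_on Sigma A B"
    using assms by (intro summable_on_SigmaI[where g = g]) (auto intro: has_sum_imp_summable)
qed

lemma has_sum_finite_sum:
  fixes f :: "'i \<Rightarrow> 'a \<Rightarrow> 'b::topological_comm_monoid_add"
  assumes "finite I" and "\<And>i. i \<in> I \<Longrightarrow> (f i has_sum s i) A"
  shows "((\<lambda>x. \<Sum>i\<in>I. f i x) has_sum (\<Sum>i\<in>I. s i)) A"
  using assms by (induction I rule: finite_induct) (auto intro: has_sum_add)

text \<open>With \<open>l = x - max u p\<close> the pairs of \<open>x\<close> and \<open>u\<close>
  become a full product \<open>{v..} \<times> UNIV\<close>, on which the double series splits into a
  geometric series and the sum of \<open>d\<close>.\<close>

lemma has_sum_geometric_convolution: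
  fixes y :: real
  assumes y: "0 \<le> y" "y < 1" and d: "(d has_sum S) {v..}" "\<And>u. 0 \<le> d u" and "v \<le> p"
  shows "((\<lambda>x. \<Sum>u=v..x. y ^ (x - max u p) * d u) has_sum inverse (1 - y) * S) {p::nat..}"
proof (rule has_sum_SigmaD)
  have "((\<lambda>(u, l). y ^ l * d u) has_sum inverse (1 - y) * S) ({v..} \<times> UNIV)"
  proof (rule has_sum_SigmaI_nonneg)
    have "((\<lambda>l. y ^ l) has_sum inverse (1 - y)) UNIV"
      using geometric_sums[of y] y by (intro sums_nonneg_imp_has_sum) (auto simp: inverse_eq_divide)
    then show "((\<lambda>l. case (u, l) of (u, l) \<Rightarrow> y ^ l * d u) has_sum inverse (1 - y) * d u) UNIV" for u
      by (simp add: has_sum_cmult_left)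
    show "((\<lambda>u. inverse (1 - y) * d u) has_sum inverse (1 - y) * S) {v..}"
      using d(1) by (rule has_sum_cmult_right)
  qed (use y d in auto)
  moreover have "((\<lambda>(x, u). y ^ (x - max u p) * d u) has_sum T) (SIGMA x:{p..}. {v..x}) \<longleftrightarrow>
      ((\<lambda>(u, l). y ^ l * d u) has_sum T) ({v..} \<times> UNIV)" for T
    by (rule has_sum_reindex_bij_witness[where i = "\<lambda>(u, l). (max u p + l, u)"
          and j = "\<lambda>(x, u). (u, x - max u p)"])
      (use \<open>v \<le> p\<close> in auto)
  ultimately show "((\<lambda>(x, u). y ^ (x - max u p) * d u) has_sum inverse (1 - y) * S)
      (SIGMA x:{p..}. {v..x})"
    by blast
  show "((\<lambda>u. case (x, u) of (x, u) \<Rightarrow> y ^ (x - max u p) * d u) has_sum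
      (\<Sum>u=v..x. y ^ (x - max u p) * d u)) {v..x}" for x
    by (simp add: has_sum_finiteI)
qed

text \<open>In the branching rule for \<open>x # \<nu>\<close> the first row contributes a power of
  \<open>y\<close> that is a geometric convolution in \<open>x\<close>, while the other rows give
  the weight of \<open>\<nu>\<close>. Each variable thus yields one factor, and the rule for
  \<open>\<nu>\<close> reassembles the rest.\<close>

lemma has_sum_dual_grothendieck_first_part:
  fixes q :: "real list"
  assumes "\<forall>x\<in>set q. 0 \<le> x \<and> x < 1" and "\<nu> \<in> partitions_of_length m"
  shows "((\<lambda>x. dual_grothendieck (x # \<nu>) q) has_sum
    (\<Prod>i<length q. inverse (1 - q ! i)) * dual_grothendieck \<nu> q) {part \<nu> 0..}"
  using assms
proof (induction q arbitrary: \<nu>)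
  case Nil
  have all: "(\<forall>i. part (x # \<nu>) i = 0) \<longleftrightarrow> x = 0 \<and> (\<forall>i. part \<nu> i = 0)" for x
    by (metis not0_implies_Suc part_Cons_0 part_Cons_Suc)
  \<comment> \<open>Without variables only \<open>x = 0\<close> can contribute, and only if
    \<open>\<nu>\<close> is zero; then \<open>part \<nu> 0 = 0\<close>.\<close>
  show ?case
    by (rule has_sum_finite_neutralI[of "{part \<nu> 0}"]) (auto simp: dual_grothendieck_Nil all)
next
  case (Cons y q)
  let ?p = "part \<nu> 0"
  let ?c = "\<Prod>i<length q. inverse (1 - q ! i)"
  let ?w = "\<lambda>\<kappa>. \<Prod>i<m. y ^ (part \<nu> i - max (part \<kappa> i) (part \<nu> (Suc i)))"
  have y: "0 \<le> y" "y < 1" and q: "\<forall>x\<in>set q. 0 \<le> x \<and> x < 1" using Cons.prems by auto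
  have "((\<lambda>x. \<Sum>\<kappa>\<in>bounded_partitions \<nu>. ?w \<kappa> *
          (\<Sum>u=part \<kappa> 0..x. y ^ (x - max u ?p) * dual_grothendieck (u # \<kappa>) q)) has_sum
        (\<Sum>\<kappa>\<in>bounded_partitions \<nu>. ?w \<kappa> * (inverse (1 - y) * (?c * dual_grothendieck \<kappa> q)))) {?p..}"
  proof (intro has_sum_finite_sum has_sum_cmult_right has_sum_geometric_convolution y
      finite_bounded_partitions)
    fix \<kappa> assume "\<kappa> \<in> bounded_partitions \<nu>"
    then have \<kappa>: "\<kappa> \<in> partitions_of_length m" "part \<kappa> 0 \<le> ?p"
      using bounded_partitions_iff[OF Cons.prems(2)] by auto
    show "((\<lambda>x. dual_grothendieck (x # \<kappa>) q) has_sum ?c * dual_grothendieck \<kappa> q) {part \<kappa> 0..}"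
      using q \<kappa>(1) by (rule Cons.IH)
    show "part \<kappa> 0 \<le> ?p" by fact
    show "0 \<le> dual_grothendieck (u # \<kappa>) q" for u
      using q by (intro dual_grothendieck_nonneg) auto
  qed
  also have "(\<Sum>\<kappa>\<in>bounded_partitions \<nu>. ?w \<kappa> * (inverse (1 - y) * (?c * dual_grothendieck \<kappa> q)))
      = (\<Prod>i<length (y # q). inverse (1 - (y # q) ! i)) * dual_grothendieck \<nu> (y # q)"
    by (simp add: dual_grothendieck_Cons[OF Cons.prems(2)] prod.lessThan_Suc_shift sum_distrib_left
        mult_ac del: prod.lessThan_Suc)
  finally show ?case
  proof (rule has_sum_cong[THEN iffD1, rotated])
    fix x assume "x \<in> {?p..}"
    then have x: "x # \<nu> \<in> partitions_of_length (Suc m)"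
      using Cons.prems by (simp add: Cons_in_partitions_of_length)
    show "(\<Sum>\<kappa>\<in>bounded_partitions \<nu>. ?w \<kappa> *
          (\<Sum>u=part \<kappa> 0..x. y ^ (x - max u ?p) * dual_grothendieck (u # \<kappa>) q))
        = dual_grothendieck (x # \<nu>) (y # q)"
      by (simp add: dual_grothendieck_Cons[OF x] sum_bounded_partitions_Cons
          prod.lessThan_Suc_shift sum_distrib_left mult_ac del: prod.lessThan_Suc)
  qed
qed

text \<open>The first \<open>k\<close> parts are unbounded above and each contributes one product of
  geometric factors. What remains has its first part bounded by \<open>a\<close>, hence lies in a
  rectangle. Parts are counted from \<open>0\<close> here.\<close>

lemma has_sum_dual_grothendieck_part_le:
  fixes q :: "real list"
  assumes q: "\<forall>x\<in>set q. 0 \<le> x \<and> x < 1" and "k < m"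
  shows "((\<lambda>\<mu>. dual_grothendieck \<mu> q) has_sum
      (\<Prod>i<length q. inverse (1 - q ! i)) ^ k *
        schur (replicate (m - k) a) (replicate (m - k) 1 @ q))
    {\<mu> \<in> partitions_of_length m. part \<mu> k \<le> a}"
  using \<open>k < m\<close>
proof (induction k arbitrary: m)
  case 0
  have rect: "replicate m a \<in> partitions_of_length m"
    by (simp add: partitions_of_length_def sorted_wrt_iff_nth_less)
  have "(\<forall>i. part \<mu> i \<le> part (replicate m a) i) \<longleftrightarrow> part \<mu> 0 \<le> a"
    if "\<mu> \<in> partitions_of_length m" for \<mu>
  proof
    assume "\<forall>i. part \<mu> i \<le> part (replicate m a) i"
    from this[rule_format, of 0] show "part \<mu> 0 \<le> a" using 0 by (simp add: part_def)
  next
    assume "part \<mu> 0 \<le> a"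
    then show "\<forall>i. part \<mu> i \<le> part (replicate m a) i"
      using order.trans[OF part_antimono[OF that le0]] part_eq_0[OF that]
      by (auto simp: part_def[of "replicate m a"] not_less)
  qed
  then have "{\<mu> \<in> partitions_of_length m. part \<mu> 0 \<le> a} = bounded_partitions (replicate m a)"
    using bounded_partitions_iff[OF rect] by auto
  then show ?case
    using sum_dual_grothendieck_rectangle[of q m a] by (simp add: has_sum_finiteI)
next
  case (Suc k)
  then obtain m' where m: "m = Suc m'" and k: "k < m'" by (cases m) auto
  let ?c = "\<Prod>i<length q. inverse (1 - q ! i)"
  let ?A = "{\<nu> \<in> partitions_of_length m'. part \<nu> k \<le> a}"
  \<comment> \<open>The partitions are fibred over their tails; prepending a part moves the bounded
    index from \<open>k\<close> to \<open>Suc k\<close>.\<close>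
  let ?B = "SIGMA \<nu>:?A. {part \<nu> 0..}"
  have "((\<lambda>(\<nu>, x). dual_grothendieck (x # \<nu>) q) has_sum
      ?c * (?c ^ k * schur (replicate (m' - k) a) (replicate (m' - k) 1 @ q))) ?B"
  proof (rule has_sum_SigmaI_nonneg)
    show "((\<lambda>\<nu>. ?c * dual_grothendieck \<nu> q) has_sum
        ?c * (?c ^ k * schur (replicate (m' - k) a) (replicate (m' - k) 1 @ q))) ?A"
      by (intro has_sum_cmult_right Suc.IH k)
    show "((\<lambda>x. case (\<nu>, x) of (\<nu>, x) \<Rightarrow> dual_grothendieck (x # \<nu>) q) has_sum
        ?c * dual_grothendieck \<nu> q) {part \<nu> 0..}" if "\<nu> \<in> ?A" for \<nu>
      using that has_sum_dual_grothendieck_first_part[OF q, of \<nu> m'] by simp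
  qed (use q in \<open>auto intro: dual_grothendieck_nonneg\<close>)
  moreover have "inj_on (\<lambda>(\<nu>, x). x # \<nu>) ?B" by (auto simp: inj_on_def)
  moreover have "(\<lambda>(\<nu>, x). x # \<nu>) ` ?B = {\<mu> \<in> partitions_of_length m. part \<mu> (Suc k) \<le> a}"
  proof -
    have "\<exists>x \<nu>. \<mu> = x # \<nu>" if "\<mu> \<in> partitions_of_length m" for \<mu>
      using that m by (cases \<mu>) (auto simp: partitions_of_length_def)
    then show ?thesis
      by (force simp: Cons_in_partitions_of_length image_iff m)
  qed
  ultimately show ?case
    using has_sum_reindex[of "\<lambda>(\<nu>, x). x # \<nu>" ?B "\<lambda>\<mu>. dual_grothendieck \<mu> q"]
    by (simp add: o_def case_prod_unfold m mult.assoc)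
qed

theorem theorem4p2:
  fixes m n k a :: nat and q :: "real list"
  assumes "m \<ge> 1" and "n \<ge> 1" and "k \<in> {1..m}"
    and "length q = n" and "\<forall>i<n. q ! i \<in> {0<..<1}"
  shows "((\<lambda>\<mu>. dual_grothendieck \<mu> q) has_sum
           (\<Prod>i<n. (1 - q ! i) powi (1 - int k)) *
             schur (replicate (m - k + 1) a) (replicate (m - k + 1) 1 @ q))
         {\<mu> \<in> partitions_of_length m. \<mu> ! (k - 1) \<le> a}"
proof -
  \<comment> \<open>The index of the bounded part counted from \<open>0\<close>, equal to the number
    of unbounded parts; \<open>1 - int k\<close> is \<open>- int l\<close>.\<close>
  obtain l where k: "k = Suc l" and l: "l < m" using assms(3) by (cases k) auto
  have "\<forall>x\<in>set q. 0 \<le> x \<and> x < 1"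
    using assms(4,5) by (force simp: in_set_conv_nth)
  from has_sum_dual_grothendieck_part_le[OF this l, of a]
  have "((\<lambda>\<mu>. dual_grothendieck \<mu> q) has_sum
      (\<Prod>i<n. inverse (1 - q ! i)) ^ l * schur (replicate (m - l) a) (replicate (m - l) 1 @ q))
    {\<mu> \<in> partitions_of_length m. part \<mu> l \<le> a}"
    using assms(4) by simp
  moreover have "(\<Prod>i<n. (1 - q ! i) powi (1 - int k)) = (\<Prod>i<n. inverse (1 - q ! i)) ^ l"
    by (simp add: k prod_power_distrib power_int_minus power_inverse)
  moreover have "m - k + 1 = m - l" using k l by simp
  moreover have "{\<mu> \<in> partitions_of_length m. \<mu> ! (k - 1) \<le> a} =
      {\<mu> \<in> partitions_of_length m. part \<mu> l \<le> a}"
    using k l by (auto simp: part_def partitions_of_length_def)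
  ultimately show ?thesis by simp
qed

end
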